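(* For every composition $\alpha=(\alpha_1,\dots,\alpha_m)$, the row-strict immaculate function satisfies \[\mathcal R\mathfrak S_\alpha=\mathbb B^{rs}_{\alpha_1}\cdots\mathbb B^{rs}_{\alpha_m}(1).\]
   Context: $\mathrm{NSym}=\mathbb Q\langle\mathbf e_1,\mathbf e_2,\dots\rangle$ (noncommuting generators of degree $n$, $\mathbf e_0=1$, $\mathbf e_n=0$ for $n<0$); $\mathbf h_n=\sum_{\beta\vDash n}(-1)^{n-\ell(\beta)}\mathbf e_{\beta_1}\cdots\mathbf e_{\beta_{\ell(\beta)}}$, $\mathbf h_\alpha=\mathbf h_{\alpha_1}\cdots\mathbf h_{\alpha_k}$. $\mathrm{QSym}$ is the algebra of quasisymmetric functions, with monomial basis $M_\alpha$ and fundamental basis $F_\alpha$, dual to $\mathrm{NSym}$ via $\langle\mathbf h_\alpha,M_\beta\rangle=\delta_{\alpha\beta}$. For $F\in\mathrm{QSym}$, $F^\perp$ is the operator on $\mathrm{NSym}$ with $\langle F^\perp(a),b\rangle=\langle a,Fb\rangle$; $F_{(0)}=1$. For $m\in\mathbb Z$, $\mathbb B^{rs}_m$ is the operator $f\mapsto\sum_{i\ge0}(-1)^i\mathbf e_{m+i}\,F^\perp_{(i)}(f)$ on $\mathrm{NSym}$. A row-strict immaculate tableau of shape $\alpha$ is a filling of the diagram of $\alpha$ ($\alpha_i$ left-justified boxes in row $i$, row 1 at bottom) by positive integers whose leftmost column weakly increases from bottom to top and whose rows strictly increase from left to right; $\mathcal R\mathfrak S^*_\alpha=\sum_U x^U$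 over such tableaux, $x^U=\prod_ix_i^{\#\{i\text{'s in }U\}}$. These form a basis of $\mathrm{QSym}$, and $\{\mathcal R\mathfrak S_\alpha\}$ is the basis of $\mathrm{NSym}$ dual to it: $\langle\mathcal R\mathfrak S_\alpha,\mathcal R\mathfrak S^*_\beta\rangle=\delta_{\alpha\beta}$. *)

theory Defs
  imports Complex_Main "HOL-Library.Poly_Mapping"
begin

section \<open>Compositions\<close>

typedef composition = "{ks :: nat list. 0 \<notin> set ks}"
  morphisms parts Composition
  by (rule exI [of _ "[]"]) simp

text \<open>Under concatenation, compositions form the free monoid on the positive integers.\<close>

instantiation composition :: monoid_add
begin

definition zero_composition :: composition where
  "0 = Composition []"

definition plus_composition :: "composition \<Rightarrow> composition \<Rightarrow> composition" where
  "\<alpha> + \<beta> = Composition (parts \<alpha> @ parts \<beta>)"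

lemma parts_zero [simp]: "parts 0 = []"
  by (simp add: zero_composition_def Composition_inverse)

lemma parts_plus [simp]: "parts (\<alpha> + \<beta>) = parts \<alpha> @ parts \<beta>"
  using parts [of \<alpha>] parts [of \<beta>] by (simp add: plus_composition_def Composition_inverse)

instance
  by standard (simp_all add: parts_inject [symmetric])

end

lemma zero_notin_parts [simp]: "0 \<notin> set (parts \<alpha>)"
  using parts [of \<alpha>] by simp

definition comp_size :: "composition \<Rightarrow> nat" where
  "comp_size \<alpha> = sum_list (parts \<alpha>)"

definition comp_len :: "composition \<Rightarrow> nat" where
  "comp_len \<alpha> = length (parts \<alpha>)"

text \<open>The composition \<open>(n)\<close>; for \<open>n = 0\<close> this is the empty composition.\<close>

definition row_comp :: "nat \<Rightarrow> composition" where
  "row_comp n = Composition (if n = 0 then [] else [n])"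

text \<open>\<open>\<beta>\<close> refines \<open>\<alpha>\<close> if \<open>\<alpha>\<close> arises from \<open>\<beta>\<close> by adding up blocks of consecutive parts.\<close>

definition refines :: "composition \<Rightarrow> composition \<Rightarrow> bool" where
  "refines \<beta> \<alpha> \<longleftrightarrow> (\<exists>kss. parts \<beta> = concat kss \<and> parts \<alpha> = map sum_list kss)"

section \<open>Noncommutative symmetric functions\<close>

text \<open>
  The free algebra on generators of degrees 1, 2, \<dots> is the monoid algebra of the
  free monoid \<^typ>\<open>composition\<close>: the product of \<^type>\<open>poly_mapping\<close> is convolution,
  and \<open>single \<alpha> 1\<close> is the word \<open>e\<^sub>\<alpha>\<^sub>1 \<dots> e\<^sub>\<alpha>\<^sub>k\<close>.
\<close>

type_synonym nsym = "composition \<Rightarrow>\<^sub>0 rat"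

definition nscale :: "rat \<Rightarrow> nsym \<Rightarrow> nsym" where
  "nscale c a = Poly_Mapping.single 0 c * a"

definition e_nsym :: "int \<Rightarrow> nsym" where
  "e_nsym n = (if n < 0 then 0 else if n = 0 then 1 else Poly_Mapping.single (row_comp (nat n)) 1)"

definition h_nsym :: "nat \<Rightarrow> nsym" where
  "h_nsym n = (\<Sum>\<beta> | comp_size \<beta> = n.
            (-1) ^ (n - comp_len \<beta>) * prod_list (map (\<lambda>k. e_nsym (int k)) (parts \<beta>)))"

definition h_comp :: "composition \<Rightarrow> nsym" where
  "h_comp \<alpha> = prod_list (map h_nsym (parts \<alpha>))"

section \<open>Quasisymmetric functions\<close>

text \<open>
  Formal power series over the rationals in \<open>x\<^sub>1, x\<^sub>2, \<dots>\<close>, as coefficient functions on exponent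
  vectors. The index 0 is not a variable: \<open>QSym\<close> only contains series that do not involve it.
\<close>

type_synonym pseries = "(nat \<Rightarrow>\<^sub>0 nat) \<Rightarrow> rat"

definition ps_times :: "pseries \<Rightarrow> pseries \<Rightarrow> pseries" where
  "ps_times f g m = (\<Sum>(p, q) | p + q = m. f p * g q)"

text \<open>The exponent vector of \<open>x\<^bsub>i\<^sub>1\<^esub>\<^bsup>k\<^sub>1\<^esup> \<dots> x\<^bsub>i\<^sub>r\<^esub>\<^bsup>k\<^sub>r\<^esup>\<close>.\<close>

definition monom_at :: "nat list \<Rightarrow> nat list \<Rightarrow> nat \<Rightarrow>\<^sub>0 nat" where
  "monom_at is ks = sum_list (map2 Poly_Mapping.single is ks)"

definition index_seq :: "nat list \<Rightarrow> composition \<Rightarrow> bool" where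
  "index_seq is \<alpha> \<longleftrightarrow> length is = comp_len \<alpha> \<and> sorted_wrt (<) is \<and> 0 \<notin> set is"

definition QSym :: "pseries set" where
  "QSym = {f.
     (\<exists>d. \<forall>m. f m \<noteq> 0 \<longrightarrow> (\<Sum>i\<in>Poly_Mapping.keys m. Poly_Mapping.lookup m i) \<le> d) \<and>
     (\<forall>m. f m \<noteq> 0 \<longrightarrow> 0 \<notin> Poly_Mapping.keys m) \<and>
     (\<forall>\<alpha> is js. index_seq is \<alpha> \<longrightarrow> index_seq js \<alpha> \<longrightarrow>
        f (monom_at is (parts \<alpha>)) = f (monom_at js (parts \<alpha>)))}"

definition M_qsym :: "composition \<Rightarrow> pseries" where
  "M_qsym \<alpha> m = (if \<exists>is. index_seq is \<alpha> \<and> m = monom_at is (parts \<alpha>) then 1 else 0)"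

definition F_qsym :: "composition \<Rightarrow> pseries" where
  "F_qsym \<alpha> m = (\<Sum>\<beta> | refines \<beta> \<alpha>. M_qsym \<beta> m)"

text \<open>
  The coefficient of \<open>M\<^sub>\<alpha>\<close> in a quasisymmetric function is its coefficient at
  \<open>x\<^sub>1\<^bsup>\<alpha>\<^sub>1\<^esup> \<dots> x\<^sub>k\<^bsup>\<alpha>\<^sub>k\<^esup>\<close>; see \<open>QSym_expansion\<close> below.
\<close>

definition M_coeff :: "pseries \<Rightarrow> composition \<Rightarrow> rat" where
  "M_coeff f \<alpha> = f (monom_at [1..<Suc (comp_len \<alpha>)] (parts \<alpha>))"

section \<open>Duality\<close>

interpretation nsym: vector_space nscale
proof
  fix a b :: rat and x y :: nsym
  show "nscale a (x + y) = nscale a x + nscale a y"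
    by (simp only: nscale_def distrib_left)
  show "nscale (a + b) x = nscale a x + nscale b x"
    by (simp only: nscale_def single_add distrib_right)
  have "Poly_Mapping.single 0 a * Poly_Mapping.single 0 b = (Poly_Mapping.single 0 (a * b) :: nsym)"
    by (simp add: mult_single)
  then show "nscale a (nscale b x) = nscale (a * b) x"
    by (metis nscale_def mult.assoc)
  show "nscale 1 x = x"
    by (simp add: nscale_def)
qed

text \<open>
  The bilinear pairing with \<open>\<langle>h\<^sub>\<alpha>, M\<^sub>\<beta>\<rangle> = \<delta>\<^sub>\<alpha>\<^sub>\<beta>\<close> (\<open>pairing_h_comp_M_qsym\<close> below);
  \<^const>\<open>nsym.representation\<close> gives the coordinates with respect to the basis of the \<open>h\<^sub>\<alpha>\<close>.
\<close>

definition pairing :: "nsym \<Rightarrow> pseries \<Rightarrow> rat" where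
  "pairing a f = Sum_any (\<lambda>\<alpha>. nsym.representation (range h_comp) a (h_comp \<alpha>) * M_coeff f \<alpha>)"

definition perp :: "pseries \<Rightarrow> nsym \<Rightarrow> nsym" where
  "perp f a = (THE c. \<forall>g\<in>QSym. pairing c g = pairing a (ps_times f g))"

text \<open>The sum has finite support, since \<open>perp\<close> by a function of degree \<open>i\<close> lowers degrees by \<open>i\<close>.\<close>

definition Brs :: "int \<Rightarrow> nsym \<Rightarrow> nsym" where
  "Brs m f = Sum_any (\<lambda>i::nat. (-1) ^ i * e_nsym (m + int i) * perp (F_qsym (row_comp i)) f)"

section \<open>Row-strict immaculate functions\<close>

text \<open>A tableau is encoded as the list of its rows from bottom to top.\<close>

definition row_strict_immaculate_tableau :: "composition \<Rightarrow> nat list list \<Rightarrow> bool" where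
  "row_strict_immaculate_tableau \<alpha> U \<longleftrightarrow>
     map length U = parts \<alpha> \<and>
     (\<forall>r\<in>set U. 0 \<notin> set r \<and> sorted_wrt (<) r) \<and>
     sorted_wrt (\<le>) (map hd U)"

definition tableau_content :: "nat list list \<Rightarrow> nat \<Rightarrow>\<^sub>0 nat" where
  "tableau_content U = (\<Sum>i\<leftarrow>concat U. Poly_Mapping.single i 1)"

definition RS_dual :: "composition \<Rightarrow> pseries" where
  "RS_dual \<alpha> m = of_nat (card {U. row_strict_immaculate_tableau \<alpha> U \<and> tableau_content U = m})"

definition RS :: "composition \<Rightarrow> nsym" where
  "RS \<alpha> = (THE a. \<forall>\<beta>. pairing a (RS_dual \<beta>) = (if \<alpha> = \<beta> then 1 else 0))"

section \<open>The pairing is well defined\<close>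

lemma parts_row_comp [simp]: "parts (row_comp n) = (if n = 0 then [] else [n])"
  by (simp add: row_comp_def Composition_inverse)

lemma length_le_sum_list: "0 \<notin> set ks \<Longrightarrow> length ks \<le> sum_list (ks :: nat list)"
  by (induction ks) (auto simp: Suc_le_eq)

lemma comp_len_le_comp_size: "comp_len \<alpha> \<le> comp_size \<alpha>"
  by (simp add: comp_len_def comp_size_def length_le_sum_list)

lemma comp_size_plus [simp]: "comp_size (\<alpha> + \<beta>) = comp_size \<alpha> + comp_size \<beta>"
  by (simp add: comp_size_def)

lemma comp_len_plus [simp]: "comp_len (\<alpha> + \<beta>) = comp_len \<alpha> + comp_len \<beta>"
  by (simp add: comp_len_def)

lemma comp_size_0 [simp]: "comp_size 0 = 0" and comp_len_0 [simp]: "comp_len 0 = 0"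
  by (simp_all add: comp_size_def comp_len_def)

lemma finite_comp_size: "finite {\<beta>. comp_size \<beta> = n}"
proof -
  have "parts ` {\<beta>. comp_size \<beta> = n} \<subseteq> {ks. set ks \<subseteq> {..n} \<and> length ks \<le> n}"
  proof clarsimp
    fix \<beta> assume "n = comp_size \<beta>"
    then show "set (parts \<beta>) \<subseteq> {..comp_size \<beta>} \<and> length (parts \<beta>) \<le> comp_size \<beta>"
      using comp_len_le_comp_size [of \<beta>] by (auto simp: comp_len_def comp_size_def intro: member_le_sum_list)
  qed
  then have "finite (parts ` {\<beta>. comp_size \<beta> = n})"
    by (rule finite_subset) (rule finite_lists_length_le, simp)
  then show ?thesis
    by (rule finite_imageD) (simp add: inj_on_def parts_inject)
qed

lemma prod_list_e_nsym: "0 \<notin> set ks \<Longrightarrow>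
    prod_list (map (\<lambda>k. e_nsym (int k)) ks) = Poly_Mapping.single (Composition ks) 1"
proof (induction ks)
  case Nil
  then show ?case by (simp flip: zero_composition_def)
next
  case (Cons k ks)
  then have "row_comp k + Composition ks = Composition (k # ks)"
    by (simp add: parts_inject [symmetric] Composition_inverse)
  with Cons show ?case by (simp add: e_nsym_def mult_single)
qed

lemma minus_one_power_mult: "(-1) ^ k * a = nscale ((-1) ^ k) a"
proof -
  have "(-1) ^ k = (Poly_Mapping.single 0 ((-1) ^ k) :: nsym)"
    by (induction k) (simp_all add: mult_single flip: single_uminus)
  then show ?thesis by (simp add: nscale_def)
qed

lemma keys_nscale: "Poly_Mapping.keys (nscale c a) \<subseteq> Poly_Mapping.keys a"
  using keys_mult [of "Poly_Mapping.single 0 c" a] by (auto simp: nscale_def split: if_splits)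

lemma nsym_sum_single: "a = (\<Sum>\<beta>\<in>Poly_Mapping.keys a. Poly_Mapping.single \<beta> (Poly_Mapping.lookup a \<beta>))"
  for a :: nsym
proof (rule poly_mapping_eqI)
  fix \<gamma>
  have "(\<Sum>\<beta>\<in>Poly_Mapping.keys a. Poly_Mapping.lookup (Poly_Mapping.single \<beta> (Poly_Mapping.lookup a \<beta>)) \<gamma>)
      = (\<Sum>\<beta>\<in>Poly_Mapping.keys a. if \<gamma> = \<beta> then Poly_Mapping.lookup a \<beta> else 0)"
    by (intro sum.cong) (auto simp: lookup_single when_def)
  then show "Poly_Mapping.lookup a \<gamma> = Poly_Mapping.lookup
      (\<Sum>\<beta>\<in>Poly_Mapping.keys a. Poly_Mapping.single \<beta> (Poly_Mapping.lookup a \<beta>)) \<gamma>"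
    by (simp add: lookup_sum in_keys_iff)
qed

lemma nscale_mult: "nscale c a * b = nscale c (a * b)" "a * nscale c b = nscale c (a * b)"
proof -
  have "a * Poly_Mapping.single 0 c = Poly_Mapping.single 0 c * a"
    by (subst (1 2) nsym_sum_single)
      (simp add: sum_distrib_left sum_distrib_right mult_single mult.commute)
  then show "nscale c a * b = nscale c (a * b)" "a * nscale c b = nscale c (a * b)"
    by (simp_all add: nscale_def mult.assoc [symmetric])
qed

definition finer :: "composition \<Rightarrow> nsym set" where
  "finer \<alpha> = {q. \<forall>\<beta>\<in>Poly_Mapping.keys q. comp_size \<beta> = comp_size \<alpha> \<and> comp_len \<alpha> < comp_len \<beta>}"

lemma h_leading:
  assumes "n > 0"
  obtains c q where "c \<noteq> 0" "h_nsym n = nscale c (Poly_Mapping.single (row_comp n) 1) + q" "q \<in> finer (row_comp n)"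
proof -
  let ?t = "\<lambda>\<beta>. nscale ((-1) ^ (n - comp_len \<beta>)) (Poly_Mapping.single \<beta> 1)"
  have h_sum: "h_nsym n = (\<Sum>\<beta> | comp_size \<beta> = n. ?t \<beta>)"
    by (simp add: h_nsym_def prod_list_e_nsym minus_one_power_mult parts_inverse)
  have row: "row_comp n \<in> {\<beta>. comp_size \<beta> = n}"
    by (simp add: comp_size_def)
  have longer: "1 < comp_len \<beta>" if "comp_size \<beta> = n" "\<beta> \<noteq> row_comp n" for \<beta>
  proof (rule ccontr)
    assume "\<not> 1 < comp_len \<beta>"
    then consider "parts \<beta> = []" | k where "parts \<beta> = [k]"
      by (cases "parts \<beta>"; cases "tl (parts \<beta>)") (auto simp: comp_len_def)
    then show False
      using that assms by cases (auto simp: comp_size_def parts_inject [symmetric])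
  qed
  show thesis
  proof (rule that)
    show "h_nsym n = ?t (row_comp n) + (\<Sum>\<beta> \<in> {\<beta>. comp_size \<beta> = n} - {row_comp n}. ?t \<beta>)"
      unfolding h_sum by (rule sum.remove [OF finite_comp_size row])
    show "(-1 :: rat) ^ (n - comp_len (row_comp n)) \<noteq> 0" by simp
    have "Poly_Mapping.keys (\<Sum>\<beta> \<in> {\<beta>. comp_size \<beta> = n} - {row_comp n}. ?t \<beta>)
        \<subseteq> (\<Union>\<beta> \<in> {\<beta>. comp_size \<beta> = n} - {row_comp n}. Poly_Mapping.keys (?t \<beta>))"
      by (rule keys_sum)
    also have "\<dots> \<subseteq> {\<beta>. comp_size \<beta> = n} - {row_comp n}"
      using keys_nscale by fastforce
    finally show "(\<Sum>\<beta> \<in> {\<beta>. comp_size \<beta> = n} - {row_comp n}. ?t \<beta>) \<in> finer (row_comp n)"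
      using longer assms row by (auto simp: finer_def comp_len_def)
  qed
qed

lemma h_comp_leading_list:
  assumes "0 \<notin> set ks"
  shows "\<exists>c q. c \<noteq> 0 \<and> q \<in> finer (Composition ks) \<and>
    prod_list (map h_nsym ks) = nscale c (Poly_Mapping.single (Composition ks) 1) + q"
  using assms
proof (induction ks)
  case Nil
  have "(0 :: nsym) \<in> finer (Composition [])" by (simp add: finer_def)
  moreover have "(1 :: nsym) = nscale 1 (Poly_Mapping.single (Composition []) 1) + 0"
    by (simp flip: zero_composition_def)
  ultimately show ?case by (metis list.map(1) prod_list.Nil zero_neq_one)
next
  case (Cons k ks)
  let ?s = "\<lambda>\<alpha>. Poly_Mapping.single \<alpha> (1 :: rat)"
  let ?\<alpha> = "Composition ks"
  from Cons.prems have k: "k > 0" and ks: "0 \<notin> set ks" by auto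
  have sum: "Composition (k # ks) = row_comp k + ?\<alpha>"
    using k ks by (simp add: parts_inject [symmetric] Composition_inverse)
  from Cons.IH [OF ks] obtain c q where 1: "c \<noteq> 0" "q \<in> finer ?\<alpha>"
    "prod_list (map h_nsym ks) = nscale c (?s ?\<alpha>) + q" by auto
  obtain d r where 2: "d \<noteq> 0" "h_nsym k = nscale d (?s (row_comp k)) + r" "r \<in> finer (row_comp k)"
    using h_leading [OF k] by blast
  let ?R = "nscale d (?s (row_comp k)) * q + r * prod_list (map h_nsym ks)"
  have "prod_list (map h_nsym (k # ks)) = nscale (d * c) (?s (row_comp k + ?\<alpha>)) + ?R"
    by (simp add: 1(3) 2(2) distrib_left distrib_right nscale_mult mult_single add.assoc
        nsym.scale_right_distrib mult.commute)
  moreover have "?R \<in> finer (row_comp k + ?\<alpha>)"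
  proof -
    have A: "Poly_Mapping.keys (nscale d (?s (row_comp k)) * q) \<subseteq> {row_comp k + b | b. b \<in> Poly_Mapping.keys q}"
      using keys_mult [of "nscale d (?s (row_comp k))" q] keys_nscale [of d "?s (row_comp k)"] by fastforce
    have "Poly_Mapping.keys (prod_list (map h_nsym ks)) \<subseteq> insert ?\<alpha> (Poly_Mapping.keys q)"
      unfolding 1(3)
      using Poly_Mapping.keys_add [of "nscale c (?s ?\<alpha>)" q] keys_nscale [of c "?s ?\<alpha>"] by fastforce
    then have B: "\<And>b. b \<in> Poly_Mapping.keys (prod_list (map h_nsym ks)) \<Longrightarrow>
        comp_size b = comp_size ?\<alpha> \<and> comp_len ?\<alpha> \<le> comp_len b"
      using 1(2) by (force simp: finer_def)
    show ?thesis
      unfolding finer_def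
    proof (intro CollectI ballI)
      fix \<beta> assume "\<beta> \<in> Poly_Mapping.keys ?R"
      then consider "\<beta> \<in> Poly_Mapping.keys (nscale d (?s (row_comp k)) * q)"
        | "\<beta> \<in> Poly_Mapping.keys (r * prod_list (map h_nsym ks))"
        using Poly_Mapping.keys_add [of "nscale d (?s (row_comp k)) * q" "r * prod_list (map h_nsym ks)"] by blast
      then show "comp_size \<beta> = comp_size (row_comp k + ?\<alpha>) \<and> comp_len (row_comp k + ?\<alpha>) < comp_len \<beta>"
      proof cases
        case 1
        then show ?thesis using A \<open>q \<in> finer ?\<alpha>\<close> by (auto simp: finer_def)
      next
        case 2
        then obtain a b where "\<beta> = a + b" "a \<in> Poly_Mapping.keys r"
            "b \<in> Poly_Mapping.keys (prod_list (map h_nsym ks))"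
          using keys_mult [of r "prod_list (map h_nsym ks)"] by blast
        then show ?thesis using B \<open>r \<in> finer (row_comp k)\<close> by (force simp: finer_def)
      qed
    qed
  qed
  moreover have "d * c \<noteq> 0" using 1 2 by simp
  ultimately show ?case unfolding sum by blast
qed

lemma h_comp_leading:
  obtains c q where "c \<noteq> 0" "q \<in> finer \<alpha>" "h_comp \<alpha> = nscale c (Poly_Mapping.single \<alpha> 1) + q"
  using h_comp_leading_list [of "parts \<alpha>"] by (auto simp: h_comp_def parts_inverse)

lemma lookup_nscale [simp]: "Poly_Mapping.lookup (nscale c a) \<beta> = c * Poly_Mapping.lookup a \<beta>"
proof -
  have "nscale c a = Poly_Mapping.map ((*) c) a"
    by (simp add: nscale_def mult_map_scale_conv_mult)
  then show ?thesis by (simp add: map.rep_eq when_def)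
qed

lemma lookup_h_comp:
  "Poly_Mapping.lookup (h_comp \<alpha>) \<alpha> \<noteq> 0"
  "comp_len \<beta> \<le> comp_len \<alpha> \<Longrightarrow> \<beta> \<noteq> \<alpha> \<Longrightarrow> Poly_Mapping.lookup (h_comp \<alpha>) \<beta> = 0"
proof -
  obtain c q where q: "c \<noteq> 0" "q \<in> finer \<alpha>" "h_comp \<alpha> = nscale c (Poly_Mapping.single \<alpha> 1) + q"
    by (rule h_comp_leading)
  have *: "Poly_Mapping.lookup q \<beta> = 0" if "comp_len \<beta> \<le> comp_len \<alpha>" for \<beta>
    using q(2) that unfolding finer_def by (metis (mono_tags, lifting) mem_Collect_eq in_keys_iff not_le)
  show "Poly_Mapping.lookup (h_comp \<alpha>) \<alpha> \<noteq> 0"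
    using q(1) * [of \<alpha>] by (simp add: q(3) lookup_add)
  show "comp_len \<beta> \<le> comp_len \<alpha> \<Longrightarrow> \<beta> \<noteq> \<alpha> \<Longrightarrow> Poly_Mapping.lookup (h_comp \<alpha>) \<beta> = 0"
    using * [of \<beta>] by (simp add: q(3) lookup_add lookup_single_not_eq)
qed

lemma inj_h_comp: "inj h_comp"
proof (rule injI)
  fix \<alpha> \<beta> assume eq: "h_comp \<alpha> = h_comp \<beta>"
  have "Poly_Mapping.lookup (h_comp \<beta>) \<alpha> \<noteq> 0" "Poly_Mapping.lookup (h_comp \<alpha>) \<beta> \<noteq> 0"
    using lookup_h_comp(1) [of \<alpha>] lookup_h_comp(1) [of \<beta>] by (simp_all only: eq not_False_eq_True)
  then show "\<alpha> = \<beta>"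
    using lookup_h_comp(2) [of \<alpha> \<beta>] lookup_h_comp(2) [of \<beta> \<alpha>]
    by (cases "comp_len \<alpha> \<le> comp_len \<beta>") fastforce+
qed

lemma independent_h_comp: "nsym.independent (range h_comp)"
  unfolding nsym.independent_explicit_module
proof (intro allI impI, rule ccontr)
  fix t u v
  assume t: "finite t" "t \<subseteq> range h_comp" and sum: "(\<Sum>v\<in>t. nscale (u v) v) = 0"
    and v: "v \<in> t" "u v \<noteq> 0"
  define S where "S = {\<alpha>. h_comp \<alpha> \<in> t \<and> u (h_comp \<alpha>) \<noteq> 0}"
  obtain \<gamma> where "\<gamma> \<in> S" using t v by (auto simp: S_def)
  then obtain \<alpha> where \<alpha>: "\<alpha> \<in> S" "\<And>\<beta>. \<beta> \<in> S \<Longrightarrow> comp_len \<alpha> \<le> comp_len \<beta>"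
    using ex_has_least_nat [of "\<lambda>\<alpha>. \<alpha> \<in> S" \<gamma> comp_len] by blast
  have "u w * Poly_Mapping.lookup w \<alpha> = 0" if w: "w \<in> t - {h_comp \<alpha>}" for w
  proof -
    obtain \<beta> where \<beta>: "w = h_comp \<beta>" using t w by blast
    show ?thesis
    proof (cases "\<beta> \<in> S")
      case True
      then show ?thesis using \<alpha> w lookup_h_comp(2) [of \<alpha> \<beta>] by (auto simp: \<beta>)
    next
      case False
      then show ?thesis using w by (auto simp: S_def \<beta>)
    qed
  qed
  then have "(\<Sum>w\<in>t. u w * Poly_Mapping.lookup w \<alpha>) = u (h_comp \<alpha>) * Poly_Mapping.lookup (h_comp \<alpha>) \<alpha>"
    using t \<alpha>(1) by (subst sum.remove [of _ "h_comp \<alpha>"]) (simp_all add: S_def sum.neutral)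
  moreover have "(\<Sum>w\<in>t. u w * Poly_Mapping.lookup w \<alpha>) = 0"
    using arg_cong [OF sum, of "\<lambda>x. Poly_Mapping.lookup x \<alpha>"] by (simp add: lookup_sum)
  ultimately show False using \<alpha>(1) lookup_h_comp(1) [of \<alpha>] by (auto simp: S_def)
qed

lemma in_spanI:
  assumes "\<And>\<beta>. \<beta> \<in> Poly_Mapping.keys a \<Longrightarrow> Poly_Mapping.single \<beta> 1 \<in> nsym.span S"
  shows "a \<in> nsym.span S"
proof -
  have "a = (\<Sum>\<beta>\<in>Poly_Mapping.keys a. nscale (Poly_Mapping.lookup a \<beta>) (Poly_Mapping.single \<beta> 1))"
    using nsym_sum_single [of a] by (simp add: nscale_def mult_single)
  also have "\<dots> \<in> nsym.span S"
    by (intro nsym.span_sum nsym.span_scale assms)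
  finally show ?thesis .
qed

lemma single_in_span: "Poly_Mapping.single \<alpha> 1 \<in> nsym.span (range h_comp)"
proof (induction "comp_size \<alpha> - comp_len \<alpha>" arbitrary: \<alpha> rule: less_induct)
  case less
  obtain c q where q: "c \<noteq> 0" "q \<in> finer \<alpha>" "h_comp \<alpha> = nscale c (Poly_Mapping.single \<alpha> 1) + q"
    by (rule h_comp_leading)
  have "Poly_Mapping.single \<beta> 1 \<in> nsym.span (range h_comp)" if "\<beta> \<in> Poly_Mapping.keys q" for \<beta>
    using q(2) that comp_len_le_comp_size [of \<beta>] by (intro less) (fastforce simp: finer_def)
  then have "q \<in> nsym.span (range h_comp)"
    by (rule in_spanI)
  moreover have "h_comp \<alpha> \<in> nsym.span (range h_comp)" by (intro nsym.span_base) simp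
  ultimately have "nscale (inverse c) (h_comp \<alpha> - q) \<in> nsym.span (range h_comp)"
    by (intro nsym.span_scale nsym.span_diff)
  then show ?case by (simp add: q(1,3))
qed

lemma span_h_comp: "nsym.span (range h_comp) = UNIV"
proof -
  have "a \<in> nsym.span (range h_comp)" for a
    by (rule in_spanI) (rule single_in_span)
  then show ?thesis by auto
qed

lemma lookup_monom_at:
  assumes "length is = length ks" "distinct is"
  shows "map (Poly_Mapping.lookup (monom_at is ks)) is = ks"
    and "i \<notin> set is \<Longrightarrow> Poly_Mapping.lookup (monom_at is ks) i = 0"
proof -
  have "map (Poly_Mapping.lookup (monom_at is ks)) is = ks \<and>
      (\<forall>i. i \<notin> set is \<longrightarrow> Poly_Mapping.lookup (monom_at is ks) i = 0)"
    using assms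
  proof (induction "is" ks rule: list_induct2)
    case (Cons i "is" k ks)
    have "map (Poly_Mapping.lookup (monom_at (i # is) (k # ks))) is
        = map (Poly_Mapping.lookup (monom_at is ks)) is"
      using Cons.prems by (auto simp: monom_at_def lookup_add lookup_single when_def)
    also have "\<dots> = ks"
      using Cons by simp
    finally have "map (Poly_Mapping.lookup (monom_at (i # is) (k # ks))) is = ks" .
    moreover have "Poly_Mapping.lookup (monom_at is ks) i = 0"
      using Cons by simp
    then have "Poly_Mapping.lookup (monom_at (i # is) (k # ks)) i = k"
      by (simp add: monom_at_def lookup_add)
    moreover have "Poly_Mapping.lookup (monom_at (i # is) (k # ks)) j = 0" if "j \<notin> set (i # is)" for j
      using Cons that by (simp add: monom_at_def lookup_add lookup_single when_def)
    ultimately show ?case by simp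
  qed (simp add: monom_at_def)
  then show "map (Poly_Mapping.lookup (monom_at is ks)) is = ks"
    and "i \<notin> set is \<Longrightarrow> Poly_Mapping.lookup (monom_at is ks) i = 0" by auto
qed

lemma keys_monom_at:
  assumes "index_seq is \<alpha>"
  shows "Poly_Mapping.keys (monom_at is (parts \<alpha>)) = set is"
proof -
  have *: "length is = length (parts \<alpha>)" "distinct is"
    using assms by (auto simp: index_seq_def comp_len_def strict_sorted_iff)
  have "Poly_Mapping.lookup (monom_at is (parts \<alpha>)) i \<noteq> 0" if "i \<in> set is" for i
    using lookup_monom_at(1) [OF *] that zero_notin_parts [of \<alpha>]
    by (metis image_eqI list.set_map)
  with lookup_monom_at(2) [OF *] show ?thesis by (auto simp: in_keys_iff)
qed

lemma monom_at_inject: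
  assumes "index_seq is \<alpha>" "index_seq js \<beta>" "monom_at is (parts \<alpha>) = monom_at js (parts \<beta>)"
  shows "\<alpha> = \<beta>"
proof -
  have "set is = set js" using keys_monom_at assms by metis
  then have eq: "is = js"
    using assms(1,2) by (auto simp: index_seq_def intro: strict_sorted_equal)
  have "length is = length (parts \<alpha>)" "length is = length (parts \<beta>)" "distinct is"
    using assms(1,2) eq by (auto simp: index_seq_def comp_len_def strict_sorted_iff)
  then have "parts \<alpha> = parts \<beta>"
    using lookup_monom_at(1) assms(3) eq by metis
  then show ?thesis by (simp add: parts_inject)
qed

lemma monom_at_exhaust:
  assumes "0 \<notin> Poly_Mapping.keys m"
  obtains "is" \<alpha> where "index_seq is \<alpha>" "m = monom_at is (parts \<alpha>)"
proof
  let ?is = "sorted_list_of_set (Poly_Mapping.keys m)"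
  let ?\<alpha> = "Composition (map (Poly_Mapping.lookup m) ?is)"
  have p: "parts ?\<alpha> = map (Poly_Mapping.lookup m) ?is"
    by (rule Composition_inverse) (auto simp: in_keys_iff)
  show "index_seq ?is ?\<alpha>"
    using assms by (simp add: index_seq_def comp_len_def p)
  have 1: "map (Poly_Mapping.lookup (monom_at ?is (parts ?\<alpha>))) ?is = map (Poly_Mapping.lookup m) ?is"
    unfolding p by (rule lookup_monom_at) simp_all
  show "m = monom_at ?is (parts ?\<alpha>)"
  proof (rule poly_mapping_eqI)
    fix i
    show "Poly_Mapping.lookup m i = Poly_Mapping.lookup (monom_at ?is (parts ?\<alpha>)) i"
    proof (cases "i \<in> Poly_Mapping.keys m")
      case True
      then show ?thesis using 1 by simp
    next
      case False
      then show ?thesis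
        using lookup_monom_at(2) [of ?is "parts ?\<alpha>" i] by (simp add: p in_keys_iff)
    qed
  qed
qed

lemma index_seq_upt: "index_seq [1..<Suc (comp_len \<alpha>)] \<alpha>"
  by (auto simp: index_seq_def simp del: upt_Suc)

lemma M_coeff_M: "M_coeff (M_qsym \<beta>) \<alpha> = (if \<alpha> = \<beta> then 1 else 0)"
proof -
  have "(\<exists>is. index_seq is \<beta> \<and> monom_at [1..<Suc (comp_len \<alpha>)] (parts \<alpha>) = monom_at is (parts \<beta>))
      \<longleftrightarrow> \<alpha> = \<beta>"
    using monom_at_inject [OF index_seq_upt] index_seq_upt by blast
  then show ?thesis by (simp only: M_coeff_def M_qsym_def)
qed

lemma QSym_expansion:
  assumes "f \<in> QSym"
  shows "f m = Sum_any (\<lambda>\<alpha>. M_coeff f \<alpha> * M_qsym \<alpha> m)"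
proof (cases "0 \<in> Poly_Mapping.keys m")
  case True
  moreover have "M_qsym \<alpha> m = 0" for \<alpha>
    using True keys_monom_at [of _ \<alpha>] by (auto simp: M_qsym_def index_seq_def)
  ultimately show ?thesis using assms by (auto simp: QSym_def)
next
  case False
  then obtain "is" \<alpha> where m: "index_seq is \<alpha>" "m = monom_at is (parts \<alpha>)"
    by (rule monom_at_exhaust)
  have M: "M_qsym \<beta> m = (if \<beta> = \<alpha> then 1 else 0)" for \<beta>
    using m monom_at_inject by (auto simp: M_qsym_def)
  have "Sum_any (\<lambda>\<beta>. M_coeff f \<beta> * M_qsym \<beta> m) = (\<Sum>\<beta>\<in>{\<alpha>}. M_coeff f \<beta> * M_qsym \<beta> m)"
    by (rule Sum_any.expand_superset) (auto simp: M split: if_splits)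
  also have "\<dots> = M_coeff f \<alpha>" by (simp add: M)
  also have "\<dots> = f m"
    using assms m index_seq_upt [of \<alpha>] unfolding QSym_def M_coeff_def by blast
  finally show ?thesis ..
qed

lemma pairing_h_comp: "pairing (h_comp \<alpha>) f = M_coeff f \<alpha>"
proof -
  have rep: "nsym.representation (range h_comp) (h_comp \<alpha>) (h_comp \<beta>) = (if \<beta> = \<alpha> then 1 else 0)" for \<beta>
    using inj_h_comp by (subst nsym.representation_basis [OF independent_h_comp]) (auto simp: inj_eq)
  have "pairing (h_comp \<alpha>) f = (\<Sum>\<beta>\<in>{\<alpha>}.
      nsym.representation (range h_comp) (h_comp \<alpha>) (h_comp \<beta>) * M_coeff f \<beta>)"
    unfolding pairing_def by (rule Sum_any.expand_superset) (auto simp: rep split: if_splits)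
  then show ?thesis by (simp add: rep)
qed

lemma pairing_h_comp_M_qsym: "pairing (h_comp \<alpha>) (M_qsym \<beta>) = (if \<alpha> = \<beta> then 1 else 0)"
  by (simp only: pairing_h_comp M_coeff_M)

lemma finite_representation_h_comp:
  "finite {\<alpha>. nsym.representation (range h_comp) a (h_comp \<alpha>) * x \<alpha> \<noteq> 0}"
proof -
  have "finite (h_comp -` {b. nsym.representation (range h_comp) a b \<noteq> 0})"
    by (rule finite_vimageI [OF nsym.finite_representation inj_h_comp])
  then show ?thesis by (rule rev_finite_subset) auto
qed

lemma representation_h_comp_linear:
  "nsym.representation (range h_comp) (a + b) v =
     nsym.representation (range h_comp) a v + nsym.representation (range h_comp) b v"
  "nsym.representation (range h_comp) (nscale c a) v = c * nsym.representation (range h_comp) a v"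
  using nsym.representation_add [OF independent_h_comp, of b a]
    nsym.representation_scale [OF independent_h_comp, of a c]
  by (simp_all add: span_h_comp)

lemma pairing_linear_left:
  "pairing (a + b) f = pairing a f + pairing b f"
  "pairing (nscale c a) f = c * pairing a f"
  unfolding pairing_def representation_h_comp_linear distrib_right mult.assoc
  by (rule Sum_any.distrib [OF finite_representation_h_comp finite_representation_h_comp])
    (rule Sum_any_right_distrib [OF finite_representation_h_comp, symmetric])

lemma pairing_linear_right:
  "pairing a (\<lambda>m. f m + g m) = pairing a f + pairing a g"
  "pairing a (\<lambda>m. c * f m) = c * pairing a f"
  unfolding pairing_def M_coeff_def distrib_left mult.left_commute [of _ c]
  by (rule Sum_any.distrib [OF finite_representation_h_comp finite_representation_h_comp])
    (rule Sum_any_right_distrib [OF finite_representation_h_comp, symmetric])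

end

theory Submission
  imports Defs
begin

text \<open>
  For \<open>n \<ge> 1\<close> the adjoint of left multiplication by \<open>e\<^sub>n\<close> sends the dual row-strict immaculate
  function of shape \<open>(\<gamma>\<^sub>1, \<gamma>')\<close> to the product of the elementary symmetric function of degree
  \<open>\<gamma>\<^sub>1 - n\<close> (0 if this is negative) and the dual function of shape \<open>\<gamma>'\<close>: once the bottom row
  contains the smallest entry, its other entries are only required to increase strictly. Since
  the one-row fundamental function of degree \<open>i\<close> is the complete symmetric function, the identity
  \<open>\<Sum>i. (-1)^i * H i * E (d - i) = 0\<close> for \<open>d > 0\<close> shows that the adjoint of the operator \<open>B\<^sub>k\<close>
  maps the dual function of shape \<open>(\<gamma>\<^sub>1, \<gamma>')\<close> to that of shape \<open>\<gamma>'\<close> if \<open>k = \<gamma>\<^sub>1\<close> and to 0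
  otherwise. So the iterated images of 1 under these operators are dual to the dual functions,
  and this determines them because they span: \<open>B\<^sub>k\<close> is left multiplication by \<open>e\<^sub>k\<close> up to
  terms starting with a later generator.
\<close>

section \<open>Coefficient functions on exponent lists\<close>

text \<open>
  A quasisymmetric function is represented by its coefficients at \<open>x\<^sub>1\<^bsup>k\<^sub>1\<^esup> \<dots> x\<^sub>r\<^bsup>k\<^sub>r\<^esup>\<close>, where zero
  exponents are allowed so that products become convolutions; quasisymmetry then amounts to
  invariance under deletion of zeros.
\<close>

fun conv :: "(nat list \<Rightarrow> rat) \<Rightarrow> (nat list \<Rightarrow> rat) \<Rightarrow> nat list \<Rightarrow> rat" where
  "conv \<phi> \<psi> [] = \<phi> [] * \<psi> []"
| "conv \<phi> \<psi> (k # ks) = (\<Sum>p\<le>k. conv (\<lambda>ps. \<phi> (p # ps)) (\<lambda>qs. \<psi> ((k - p) # qs)) ks)"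

definition zero_invariant :: "(nat list \<Rightarrow> rat) \<Rightarrow> bool" where
  "zero_invariant \<phi> \<longleftrightarrow> (\<forall>ks. \<phi> (removeAll 0 ks) = \<phi> ks)"

definition complete_coeff :: "nat \<Rightarrow> nat list \<Rightarrow> rat" where
  "complete_coeff i ks = (if sum_list ks = i then 1 else 0)"

definition elementary_coeff :: "nat \<Rightarrow> nat list \<Rightarrow> rat" where
  "elementary_coeff j ks = (if sum_list ks = j \<and> (\<forall>k\<in>set ks. k \<le> 1) then 1 else 0)"

lemma conv_sum_left: "conv (\<lambda>ks. \<Sum>i\<in>I. c i * \<phi> i ks) \<psi> ks = (\<Sum>i\<in>I. c i * conv (\<phi> i) \<psi> ks)"
proof (induction ks arbitrary: \<phi> \<psi>)
  case (Cons k ks)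
  show ?case
    by (simp add: Cons sum_distrib_left) (rule sum.swap)
qed (simp add: sum_distrib_right sum_distrib_left mult.assoc)

lemma conv_sum_right: "conv \<phi> (\<lambda>ks. \<Sum>i\<in>I. c i * \<psi> i ks) ks = (\<Sum>i\<in>I. c i * conv \<phi> (\<psi> i) ks)"
proof (induction ks arbitrary: \<phi> \<psi>)
  case (Cons k ks)
  show ?case
    by (simp add: Cons sum_distrib_left) (rule sum.swap)
qed (simp add: sum_distrib_left mult.left_commute)

lemma conv_0_left [simp]: "conv (\<lambda>ks. 0) \<psi> ks = 0"
  and conv_0_right [simp]: "conv \<phi> (\<lambda>ks. 0) ks = 0"
  using conv_sum_left [of "\<lambda>_. 0" _ "{}"] conv_sum_right [of _ "\<lambda>_. 0" _ "{}"] by simp_all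

lemma conv_assoc: "conv (conv \<phi> \<psi>) \<chi> ks = conv \<phi> (conv \<psi> \<chi>) ks"
proof (induction ks arbitrary: \<phi> \<psi> \<chi>)
  case (Cons k ks)
  let ?t = "\<lambda>a b c. conv (conv (\<lambda>ps. \<phi> (a # ps)) (\<lambda>ps. \<psi> (b # ps))) (\<lambda>ps. \<chi> (c # ps)) ks"
  have "conv (conv \<phi> \<psi>) \<chi> (k # ks) = (\<Sum>p\<le>k. \<Sum>a\<le>p. ?t a (p - a) (k - p))"
    by (simp add: conv_sum_left [of "\<lambda>_. 1", simplified])
  also have "\<dots> = (\<Sum>a\<le>k. \<Sum>b\<le>k - a. ?t a b (k - a - b))"
    unfolding sum.Sigma [OF finite_atMost ballI [OF finite_atMost]]
    by (rule sum.reindex_bij_witness [of _ "\<lambda>(a, b). (a + b, a)" "\<lambda>(p, a). (a, p - a)"])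
      auto
  also have "\<dots> = conv \<phi> (conv \<psi> \<chi>) (k # ks)"
    by (simp add: Cons conv_sum_right [of _ "\<lambda>_. 1", simplified])
  finally show ?case .
qed simp

lemma zero_invariant_Cons_0: "zero_invariant \<phi> \<Longrightarrow> \<phi> (0 # ks) = \<phi> ks"
  unfolding zero_invariant_def by (metis removeAll.simps(2))

lemma zero_invariant_Cons: "zero_invariant \<phi> \<Longrightarrow> zero_invariant (\<lambda>ks. \<phi> (k # ks))"
  unfolding zero_invariant_def
  by (metis removeAll.simps(2) removeAll_id removeAll_filter_not_eq filter_filter)

text \<open>A leading zero splits only as 0 + 0, so it reaches both factors and may be deleted
  there. Prefixing a letter keeps each factor invariant, so the induction continues.\<close>

lemma zero_invariant_conv:
  assumes "zero_invariant \<phi>" "zero_invariant \<psi>"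
  shows "zero_invariant (conv \<phi> \<psi>)"
proof -
  have "conv \<phi> \<psi> (removeAll 0 ks) = conv \<phi> \<psi> ks" for ks
    using assms
  proof (induction ks arbitrary: \<phi> \<psi>)
    case (Cons k ks)
    have "conv \<phi> \<psi> (0 # ks) = conv \<phi> \<psi> ks"
      using Cons.prems by (simp add: zero_invariant_Cons_0)
    moreover have "conv \<phi> \<psi> (k # removeAll 0 ks) = conv \<phi> \<psi> (k # ks)"
      using Cons.prems by (simp add: Cons.IH zero_invariant_Cons)
    ultimately show ?case
      using Cons by auto
  qed simp
  then show ?thesis by (simp add: zero_invariant_def)
qed

lemma sum_list_removeAll_0 [simp]: "sum_list (removeAll 0 ks) = sum_list (ks :: nat list)"
  by (induction ks) auto

lemma zero_invariant_complete: "zero_invariant (complete_coeff i)"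
  by (simp add: zero_invariant_def complete_coeff_def)

lemma zero_invariant_elementary: "zero_invariant (elementary_coeff j)"
  by (auto simp: zero_invariant_def elementary_coeff_def)

section \<open>Products of elementary and complete symmetric functions\<close>

lemma complete_Cons: "complete_coeff i (k # ks) = (if k \<le> i then complete_coeff (i - k) ks else 0)"
  by (auto simp: complete_coeff_def)

lemma elementary_Cons_0: "elementary_coeff j (0 # ks) = elementary_coeff j ks"
  by (simp add: elementary_coeff_def)

lemma elementary_Cons_1: "elementary_coeff j (Suc 0 # ks) = (if j = 0 then 0 else elementary_coeff (j - 1) ks)"
  by (auto simp: elementary_coeff_def)

text \<open>An elementary function has no exponent above 1, so it takes either nothing or exactly
  one factor from the first variable.\<close>

lemma conv_elementary_Cons:
  "conv (elementary_coeff j) \<psi> (k # ks) = conv (elementary_coeff j) (\<lambda>qs. \<psi> (k # qs)) ks +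
     (if k = 0 \<or> j = 0 then 0 else conv (elementary_coeff (j - 1)) (\<lambda>qs. \<psi> ((k - 1) # qs)) ks)"
proof -
  let ?t = "\<lambda>p. conv (\<lambda>ps. elementary_coeff j (p # ps)) (\<lambda>qs. \<psi> ((k - p) # qs)) ks"
  have "?t p = 0" if "p > 1" for p
    using that by (simp add: elementary_coeff_def)
  then have "conv (elementary_coeff j) \<psi> (k # ks) = (\<Sum>p\<in>{..k} \<inter> {..1}. ?t p)"
    unfolding conv.simps by (intro sum.mono_neutral_right ballI) auto
  also have "{..k} \<inter> {..1} = (if k = 0 then {0} else {0, 1})"
    by auto
  finally show ?thesis
    by (simp add: elementary_Cons_0 elementary_Cons_1)
qed

text \<open>A monomial of degree i + j arises once for each choice of j variables from its support,
  each giving one factor to the elementary function. Pascal's rule performs the induction.\<close>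

lemma conv_elementary_complete:
  "conv (elementary_coeff j) (complete_coeff i) ks =
     (if sum_list ks = i + j then of_nat (length (removeAll 0 ks) choose j) else 0)"
proof (induction ks arbitrary: i j)
  case Nil
  show ?case by (auto simp: elementary_coeff_def complete_coeff_def)
next
  case (Cons k ks)
  show ?case
  proof (cases j)
    case 0
    then show ?thesis
      by (cases "k \<le> i") (auto simp: conv_elementary_Cons complete_Cons Cons simp del: conv.simps)
  next
    case (Suc l)
    show ?thesis
    proof (cases k)
      case 0
      then show ?thesis by (simp add: conv_elementary_Cons complete_Cons Cons Suc del: conv.simps)
    next
      case (Suc k')
      \<comment> \<open>If the first exponent exceeds \<open>i\<close>, terms drop out of the
        convolution; the matching binomial coefficients vanish because the support is no larger than
        the degree.\<close>
      then show ?thesis using \<open>j = Suc l\<close> length_le_sum_list [of "removeAll 0 ks"]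
        by (cases "Suc k' \<le> i"; cases "k' \<le> i") (auto simp: binomial_eq_0 conv_elementary_Cons complete_Cons Cons simp del: conv.simps)
    qed
  qed
qed

lemma conv_unit_left: "conv (complete_coeff 0) \<psi> ks = \<psi> ks"
proof (induction ks arbitrary: \<psi>)
  case (Cons k ks)
  have "conv (complete_coeff 0) \<psi> (k # ks) =
      (\<Sum>p\<in>{0}. conv (\<lambda>ps. complete_coeff 0 (p # ps)) (\<lambda>qs. \<psi> ((k - p) # qs)) ks)"
    unfolding conv.simps by (intro sum.mono_neutral_right) (auto simp: complete_Cons)
  then show ?case by (simp add: complete_Cons Cons)
qed (simp add: complete_coeff_def)

lemma conv_commute: "conv \<phi> \<psi> ks = conv \<psi> \<phi> ks"
proof (induction ks arbitrary: \<phi> \<psi>)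
  case (Cons k ks)
  show ?case unfolding conv.simps Cons [of "\<lambda>ps. \<phi> (_ # ps)"]
    by (rule sum.reindex_bij_witness [of _ "\<lambda>p. k - p" "\<lambda>p. k - p"]) auto
qed simp

text \<open>Coefficientwise this is the alternating sum of a row of Pascal's triangle, the row being
  indexed by the size of the support.\<close>

lemma alternating_sum_conv:
  "(\<Sum>i\<le>j. (-1) ^ i * conv (complete_coeff i) (elementary_coeff (j - i)) ks) = (if j = 0 then complete_coeff 0 ks else 0)"
proof (cases "sum_list ks = j")
  case True
  let ?s = "length (removeAll 0 ks)"
  have le: "?s \<le> j"
    using length_le_sum_list [of "removeAll 0 ks"] True by simp
  have "(\<Sum>i\<le>j. (-1) ^ i * conv (complete_coeff i) (elementary_coeff (j - i)) ks)
      = (\<Sum>i\<le>j. (-1) ^ i * of_nat (?s choose (j - i)))"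
    using True by (intro sum.cong) (simp_all add: conv_commute [of "complete_coeff _"] conv_elementary_complete)
  also have "\<dots> = (\<Sum>i\<le>j. (-1) ^ (j - i) * of_nat (?s choose i))"
    by (rule sum.reindex_bij_witness [of _ "\<lambda>p. j - p" "\<lambda>p. j - p"]) auto
  also have "\<dots> = (-1) ^ j * (\<Sum>i\<le>j. (-1) ^ i * of_nat (?s choose i))"
    unfolding sum_distrib_left
    by (intro sum.cong refl) (auto simp: power_add [symmetric] mult.assoc [symmetric] uminus_power_if)
  \<comment> \<open>The support has at most \<open>j\<close> elements, so the truncated sum already
    contains the whole row.\<close>
  also have "(\<Sum>i\<le>j. (-1) ^ i * of_nat (?s choose i)) = (\<Sum>i\<le>?s. (-1) ^ i * of_nat (?s choose i) :: rat)"
    using le by (intro sum.mono_neutral_right) (auto simp: binomial_eq_0)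
  also have "\<dots> = (if ?s = 0 then 1 else 0)"
    using choose_alternating_sum [of ?s, where 'a = rat] by (cases "?s = 0") auto
  also have "?s = 0 \<longleftrightarrow> j = 0"
    using True by (auto simp: removeAll_filter_not_eq filter_empty_conv)
  finally show ?thesis
    using True by (simp add: complete_coeff_def [of _ ks])
next
  case False
  then show ?thesis
    by (cases "j = 0") (auto simp: conv_commute [of "complete_coeff _"] conv_elementary_complete complete_coeff_def)
qed

section \<open>The coefficient pairing\<close>

text \<open>The pairing extended to arbitrary functions on lists: adjoints can then be computed
  without exhibiting a power series for every function that occurs.\<close>

definition coeff_pairing :: "nsym \<Rightarrow> (nat list \<Rightarrow> rat) \<Rightarrow> rat" where
  "coeff_pairing a \<phi> = Sum_any (\<lambda>\<alpha>. nsym.representation (range h_comp) a (h_comp \<alpha>) * \<phi> (parts \<alpha>))"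

definition coeff_fun :: "pseries \<Rightarrow> nat list \<Rightarrow> rat" where
  "coeff_fun f ks = f (monom_at [1..<Suc (length ks)] ks)"

lemma pairing_eq_coeff_pairing: "pairing a f = coeff_pairing a (coeff_fun f)"
  by (simp add: pairing_def coeff_pairing_def coeff_fun_def M_coeff_def comp_len_def del: upt_Suc)

lemma coeff_pairing_h_comp: "coeff_pairing (h_comp \<alpha>) \<phi> = \<phi> (parts \<alpha>)"
proof -
  have rep: "nsym.representation (range h_comp) (h_comp \<alpha>) (h_comp \<beta>) = (if \<beta> = \<alpha> then 1 else 0)" for \<beta>
    using inj_h_comp by (subst nsym.representation_basis [OF independent_h_comp]) (auto simp: inj_eq)
  have "coeff_pairing (h_comp \<alpha>) \<phi> = (\<Sum>\<beta>\<in>{\<alpha>}.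
      nsym.representation (range h_comp) (h_comp \<alpha>) (h_comp \<beta>) * \<phi> (parts \<beta>))"
    unfolding coeff_pairing_def by (rule Sum_any.expand_superset) (auto simp: rep split: if_splits)
  then show ?thesis by (simp add: rep)
qed

lemma coeff_pairing_add [simp]: "coeff_pairing (a + b) \<phi> = coeff_pairing a \<phi> + coeff_pairing b \<phi>"
  unfolding coeff_pairing_def representation_h_comp_linear distrib_right
  by (rule Sum_any.distrib [OF finite_representation_h_comp finite_representation_h_comp])

lemma coeff_pairing_nscale [simp]: "coeff_pairing (nscale c a) \<phi> = c * coeff_pairing a \<phi>"
  unfolding coeff_pairing_def representation_h_comp_linear mult.assoc
  by (rule Sum_any_right_distrib [OF finite_representation_h_comp, symmetric])

lemma coeff_pairing_0 [simp]: "coeff_pairing 0 \<phi> = 0"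
  using coeff_pairing_nscale [of 0 0] by simp

lemma coeff_pairing_sum: "coeff_pairing (\<Sum>i\<in>I. x i) \<phi> = (\<Sum>i\<in>I. coeff_pairing (x i) \<phi>)"
  by (induction I rule: infinite_finite_induct) auto

lemma coeff_pairing_minus_one_power [simp]:
  "coeff_pairing ((-1) ^ i * a) \<phi> = (-1) ^ i * coeff_pairing a \<phi>"
  by (simp add: minus_one_power_mult)

lemma nsym_induct [case_names zero add scale h_comp]:
  assumes "P 0" "\<And>a b. P a \<Longrightarrow> P b \<Longrightarrow> P (a + b)" "\<And>c a. P a \<Longrightarrow> P (nscale c a)"
    and "\<And>\<alpha>. P (h_comp \<alpha>)"
  shows "P a"
proof -
  have "a \<in> nsym.span (range h_comp)"
    by (simp add: span_h_comp)
  then show ?thesis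
    by (rule nsym.span_induct) (auto intro: assms nsym.subspaceI)
qed

lemma coeff_pairing_sum_right:
  "coeff_pairing a (\<lambda>ks. \<Sum>i\<in>I. c i * \<phi> i ks) = (\<Sum>i\<in>I. c i * coeff_pairing a (\<phi> i))"
  by (induction a rule: nsym_induct)
    (simp_all add: coeff_pairing_h_comp sum.distrib distrib_left sum_distrib_left mult.left_commute)

lemma h_nsym_0: "h_nsym 0 = 1"
proof -
  have "\<beta> = 0" if "comp_size \<beta> = 0" for \<beta>
    using that comp_len_le_comp_size [of \<beta>] by (simp add: comp_len_def parts_inject [symmetric])
  then have "{\<beta>. comp_size \<beta> = 0} = {0}"
    by auto
  then show ?thesis by (simp add: h_nsym_def)
qed

text \<open>Zero parts are allowed and contribute h_0 = 1, in accordance with the zero exponents of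
  coefficient functions.\<close>

definition h_list :: "nat list \<Rightarrow> nsym" where
  "h_list ks = prod_list (map h_nsym ks)"

lemma h_list_Cons: "h_list (k # ks) = h_nsym k * h_list ks"
  by (simp add: h_list_def)

lemma h_comp_eq_h_list: "h_comp \<alpha> = h_list (parts \<alpha>)"
  by (simp add: h_comp_def h_list_def)

lemma parts_Composition_removeAll [simp]: "parts (Composition (removeAll 0 ks)) = removeAll 0 ks"
  by (simp add: Composition_inverse)

lemma h_list_eq_h_comp: "h_list ks = h_comp (Composition (removeAll 0 ks))"
  unfolding h_comp_eq_h_list parts_Composition_removeAll
  by (induction ks) (simp_all add: h_list_def h_nsym_0)

lemma coeff_pairing_h_list: "zero_invariant \<phi> \<Longrightarrow> coeff_pairing (h_list ks) \<phi> = \<phi> ks"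
  by (simp add: h_list_eq_h_comp coeff_pairing_h_comp zero_invariant_def)

lemma coeff_pairing_1: "zero_invariant \<phi> \<Longrightarrow> coeff_pairing 1 \<phi> = \<phi> []"
  using coeff_pairing_h_list [of \<phi> "[]"] by (simp add: h_list_def)

section \<open>Products of power series\<close>

lemma keys_monom_at_subset:
  assumes "length is = length ks" "distinct is"
  shows "Poly_Mapping.keys (monom_at is ks) \<subseteq> set is"
  using lookup_monom_at(2) [OF assms] by (auto simp: in_keys_iff)

lemma sum_lookup_monom_at:
  assumes "length is = length ks" "distinct is"
  shows "(\<Sum>i\<in>Poly_Mapping.keys (monom_at is ks). Poly_Mapping.lookup (monom_at is ks) i) = sum_list ks"
proof -
  have "(\<Sum>i\<in>Poly_Mapping.keys (monom_at is ks). Poly_Mapping.lookup (monom_at is ks) i)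
      = (\<Sum>i\<in>set is. Poly_Mapping.lookup (monom_at is ks) i)"
    using keys_monom_at_subset [OF assms]
    by (intro sum.mono_neutral_left) (auto simp: in_keys_iff)
  also have "\<dots> = sum_list (map (Poly_Mapping.lookup (monom_at is ks)) is)"
    using assms(2) by (simp add: sum_list_distinct_conv_sum_set)
  finally show ?thesis
    by (simp only: lookup_monom_at(1) [OF assms])
qed

lemma monom_at_Nil [simp]: "monom_at [] ks = 0"
  by (simp add: monom_at_def)

lemma monom_at_Cons [simp]: "monom_at (i # is) (k # ks) = Poly_Mapping.single i k + monom_at is ks"
  by (simp add: monom_at_def)

lemma monom_at_upt_Cons:
  "monom_at [s..<s + length (k # ks)] (k # ks)
     = Poly_Mapping.single s k + monom_at [Suc s..<Suc s + length ks] ks"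
  by (subst upt_conv_Cons) simp_all

lemma single_add_eq_iff:
  fixes p q m :: "nat \<Rightarrow>\<^sub>0 nat"
  assumes "Poly_Mapping.lookup m s = 0"
  shows "p + q = Poly_Mapping.single s k + m \<longleftrightarrow>
    (\<exists>a\<le>k. \<exists>p' q'. p' + q' = m \<and> p = Poly_Mapping.single s a + p' \<and> q = Poly_Mapping.single s (k - a) + q')"
    (is "?L \<longleftrightarrow> ?R")
proof
  assume ?L
  then have *: "Poly_Mapping.lookup p i + Poly_Mapping.lookup q i = (k when s = i) + Poly_Mapping.lookup m i" for i
    by (metis lookup_add lookup_single)
  let ?a = "Poly_Mapping.lookup p s"
  let ?p = "p - Poly_Mapping.single s ?a" and ?q = "q - Poly_Mapping.single s (k - ?a)"
  have a: "?a + Poly_Mapping.lookup q s = k"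
    using * [of s] assms by simp
  have "?p + ?q = m"
  proof (rule poly_mapping_eqI)
    fix i
    show "Poly_Mapping.lookup (?p + ?q) i = Poly_Mapping.lookup m i"
      using * [of i] a assms by (cases "i = s") (auto simp: lookup_add lookup_minus lookup_single)
  qed
  moreover have "p = Poly_Mapping.single s ?a + ?p" "q = Poly_Mapping.single s (k - ?a) + ?q"
    by (rule poly_mapping_eqI; use a in \<open>auto simp: lookup_add lookup_minus lookup_single when_def\<close>)+
  moreover have "?a \<le> k"
    using a by simp
  ultimately show ?R by blast
next
  assume ?R
  then obtain a p' q' where "a \<le> k" and *: "p' + q' = m"
    "p = Poly_Mapping.single s a + p'" "q = Poly_Mapping.single s (k - a) + q'"
    by blast
  then have "Poly_Mapping.single s k = Poly_Mapping.single s a + (Poly_Mapping.single s (k - a) :: nat \<Rightarrow>\<^sub>0 nat)"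
    by (simp add: single_add [symmetric])
  then show ?L unfolding * by (simp add: add.assoc add.left_commute *(1) [symmetric])
qed

lemma add_single_inject:
  fixes m p q p' q' :: "nat \<Rightarrow>\<^sub>0 nat"
  assumes "Poly_Mapping.lookup m s = 0" "p + q = m" "p' + q' = m"
    and "Poly_Mapping.single s a + p = Poly_Mapping.single s b + p'"
  shows "a = b \<and> p = p'"
proof -
  have "Poly_Mapping.lookup p s = 0" "Poly_Mapping.lookup p' s = 0"
    using assms(1-3) by (metis lookup_add add_is_0)+
  then have "a = b"
    using arg_cong [OF assms(4), of "\<lambda>x. Poly_Mapping.lookup x s"] by (simp add: lookup_add)
  then show ?thesis using assms(4) by simp
qed

text \<open>The variable x_s is absent from \<open>m\<close>, so its exponent \<open>k\<close> is
  split between the factors independently of the rest.\<close>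

lemma decompositions_single_add:
  fixes m :: "nat \<Rightarrow>\<^sub>0 nat"
  assumes "Poly_Mapping.lookup m s = 0"
  shows "{(p, q). p + q = Poly_Mapping.single s k + m} =
    (\<lambda>(a, p, q). (Poly_Mapping.single s a + p, Poly_Mapping.single s (k - a) + q)) ` ({..k} \<times> {(p, q). p + q = m})"
  unfolding single_add_eq_iff [OF assms] by (force simp: image_iff)

lemma inj_on_decompositions:
  fixes m :: "nat \<Rightarrow>\<^sub>0 nat"
  assumes "Poly_Mapping.lookup m s = 0"
  shows "inj_on (\<lambda>(a, p, q). (Poly_Mapping.single s a + p, Poly_Mapping.single s (k - a) + q))
    ({..k} \<times> {(p, q). p + q = m})"
  using add_single_inject [OF assms] by (fastforce simp: inj_on_def)

lemma monom_at_upt_lookup_0: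
  assumes "i < s"
  shows "Poly_Mapping.lookup (monom_at [s..<s + length ks] ks) i = 0"
  using assms by (intro lookup_monom_at(2)) auto

text \<open>Peeling off x_s splits its exponent between the factors, as in \<open>conv\<close>. The
  start index is general because the remaining variables begin at s + 1; \<open>f\<close> and
  \<open>g\<close> vary because they absorb the exponents already chosen.\<close>

lemma ps_times_monom_at:
  "ps_times f g (monom_at [s..<s + length ks] ks) =
     conv (\<lambda>ps. f (monom_at [s..<s + length ps] ps)) (\<lambda>qs. g (monom_at [s..<s + length qs] qs)) ks"
proof (induction ks arbitrary: f g s)
  case Nil
  have "{(p, q). p + q = (0 :: nat \<Rightarrow>\<^sub>0 nat)} = {(0, 0)}"
    by (auto simp: poly_mapping_eq_iff lookup_add fun_eq_iff)
  then show ?case by (simp add: ps_times_def)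
next
  case (Cons k ks)
  let ?m = "monom_at [Suc s..<Suc s + length ks] ks"
  have "ps_times f g (monom_at [s..<s + length (k # ks)] (k # ks)) =
    (\<Sum>(a, p, q)\<in>{..k} \<times> {(p, q). p + q = ?m}. f (Poly_Mapping.single s a + p) * g (Poly_Mapping.single s (k - a) + q))"
    unfolding ps_times_def monom_at_upt_Cons decompositions_single_add [OF monom_at_upt_lookup_0 [OF lessI]]
    by (subst sum.reindex [OF inj_on_decompositions [OF monom_at_upt_lookup_0 [OF lessI]]])
      (simp add: case_prod_unfold)
  also have "\<dots> = (\<Sum>a\<le>k. ps_times (\<lambda>p. f (Poly_Mapping.single s a + p)) (\<lambda>q. g (Poly_Mapping.single s (k - a) + q)) ?m)"
    by (simp add: sum.cartesian_product [symmetric] ps_times_def)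
  finally show ?case
    unfolding Cons conv.simps monom_at_upt_Cons .
qed

lemma coeff_fun_ps_times: "coeff_fun (ps_times f g) ks = conv (coeff_fun f) (coeff_fun g) ks"
  using ps_times_monom_at [of f g 1 ks] by (simp add: coeff_fun_def [abs_def] del: upt_Suc)

section \<open>Coefficient functions of quasisymmetric series\<close>

lemma M_qsym_monom_at: "index_seq is \<alpha> \<Longrightarrow> M_qsym \<beta> (monom_at is (parts \<alpha>)) = (if \<beta> = \<alpha> then 1 else 0)"
  using monom_at_inject by (auto simp: M_qsym_def)

lemma index_seq_imp:
  "index_seq is \<alpha> \<Longrightarrow> length is = length (parts \<alpha>)" "index_seq is \<alpha> \<Longrightarrow> distinct is"
  by (auto simp: index_seq_def comp_len_def strict_sorted_iff)

lemma M_qsym_in_QSym: "M_qsym \<beta> \<in> QSym"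
  unfolding QSym_def
proof (intro CollectI conjI exI allI impI)
  fix m assume "M_qsym \<beta> m \<noteq> 0"
  then obtain "is" where *: "index_seq is \<beta>" "m = monom_at is (parts \<beta>)"
    by (auto simp: M_qsym_def split: if_splits)
  show "(\<Sum>i\<in>Poly_Mapping.keys m. Poly_Mapping.lookup m i) \<le> comp_size \<beta>"
    unfolding *(2) by (simp add: sum_lookup_monom_at index_seq_imp [OF *(1)] comp_size_def)
  show "0 \<notin> Poly_Mapping.keys m"
    using * by (simp add: keys_monom_at) (simp add: index_seq_def)
next
  fix \<alpha> "is" js assume "index_seq is \<alpha>" "index_seq js \<alpha>"
  then show "M_qsym \<beta> (monom_at is (parts \<alpha>)) = M_qsym \<beta> (monom_at js (parts \<alpha>))"
    by (simp add: M_qsym_monom_at)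
qed

lemma refines_row_comp: "refines \<beta> (row_comp i) \<longleftrightarrow> comp_size \<beta> = i"
proof
  assume "refines \<beta> (row_comp i)"
  then obtain kss where "parts \<beta> = concat kss" "parts (row_comp i) = map sum_list kss"
    by (auto simp: refines_def)
  moreover have "sum_list (concat kss) = sum_list (map sum_list kss)"
    by (induction kss) simp_all
  ultimately have "comp_size \<beta> = sum_list (parts (row_comp i))"
    by (simp add: comp_size_def)
  then show "comp_size \<beta> = i" by (simp split: if_splits)
next
  assume "comp_size \<beta> = i"
  then show "refines \<beta> (row_comp i)"
    using length_le_sum_list [OF zero_notin_parts, of \<beta>]
    \<comment> \<open>There is one block, except for i = 0, where \<open>row_comp 0\<close> is empty
      and no block is allowed.\<close>
    by (auto simp: refines_def comp_size_def intro: exI [of _ "[parts \<beta>]"] exI [of _ "[]"])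
qed

text \<open>Every monomial without x_0 occurs in exactly one \<open>M_qsym \<alpha>\<close>, so the
  sum over all compositions of i counts each monomial of degree i once.\<close>

lemma coeff_fun_F_qsym_row_comp: "coeff_fun (F_qsym (row_comp i)) = complete_coeff i"
proof
  fix ks
  let ?m = "monom_at [1..<Suc (length ks)] ks"
  have len: "length [1..<Suc (length ks)] = length ks" "distinct [1..<Suc (length ks)]"
    by (simp_all del: upt_Suc)
  have "0 \<notin> Poly_Mapping.keys ?m"
    using keys_monom_at_subset [OF len] by (auto simp del: upt_Suc)
  then obtain "is" \<alpha> where m: "index_seq is \<alpha>" "?m = monom_at is (parts \<alpha>)"
    by (rule monom_at_exhaust)
  have "sum_list ks = comp_size \<alpha>"
    using sum_lookup_monom_at [OF len] sum_lookup_monom_at [OF index_seq_imp [OF m(1)]]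
    unfolding m(2) comp_size_def by simp
  moreover have "F_qsym (row_comp i) ?m = (\<Sum>\<beta> | comp_size \<beta> = i. if \<beta> = \<alpha> then 1 else 0)"
    unfolding F_qsym_def refines_row_comp m(2) M_qsym_monom_at [OF m(1)] ..
  ultimately show "coeff_fun (F_qsym (row_comp i)) ks = complete_coeff i ks"
    by (simp add: coeff_fun_def complete_coeff_def sum.delta finite_comp_size del: upt_Suc)
qed

lemma monom_at_removeAll:
  assumes "length is = length ks" "sorted_wrt (<) is"
  obtains js where "length js = length (removeAll 0 ks)" "sorted_wrt (<) js" "set js \<subseteq> set is"
    "monom_at js (removeAll 0 ks) = monom_at is ks"
proof -
  have "\<exists>js. length js = length (removeAll 0 ks) \<and> sorted_wrt (<) js \<and> set js \<subseteq> set is \<and>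
      monom_at js (removeAll 0 ks) = monom_at is ks"
    using assms
  proof (induction "is" ks rule: list_induct2)
    case (Cons i "is" k ks)
    then obtain js where js: "length js = length (removeAll 0 ks)" "sorted_wrt (<) js" "set js \<subseteq> set is"
      "monom_at js (removeAll 0 ks) = monom_at is ks"
      by auto
    show ?case
    proof (cases "k = 0")
      case True
      with js show ?thesis by (intro exI [of _ js]) auto
    next
      case False
      with js Cons.prems show ?thesis by (intro exI [of _ "i # js"]) auto
    qed
  qed simp
  then show thesis using that by blast
qed

text \<open>Zero exponents drop their variables from the monomial; quasisymmetry then moves the
  surviving variables to the initial ones.\<close>

lemma zero_invariant_coeff_fun:
  assumes "g \<in> QSym"
  shows "zero_invariant (coeff_fun g)"
  unfolding zero_invariant_def
proof
  fix ks
  let ?\<alpha> = "Composition (removeAll 0 ks)"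
  have "length [1..<Suc (length ks)] = length ks" "sorted_wrt (<) [1..<Suc (length ks)]"
    by (simp_all del: upt_Suc)
  then obtain js where js: "length js = length (removeAll 0 ks)" "sorted_wrt (<) js"
    "set js \<subseteq> set [1..<Suc (length ks)]"
    "monom_at js (removeAll 0 ks) = monom_at [1..<Suc (length ks)] ks"
    by (rule monom_at_removeAll)
  then have "index_seq js ?\<alpha>"
    by (auto simp: index_seq_def comp_len_def simp del: upt_Suc)
  with index_seq_upt have "g (monom_at [1..<Suc (comp_len ?\<alpha>)] (parts ?\<alpha>)) = g (monom_at js (parts ?\<alpha>))"
    using assms unfolding QSym_def by blast
  then show "coeff_fun g (removeAll 0 ks) = coeff_fun g ks"
    using js(4) by (simp add: coeff_fun_def comp_len_def del: upt_Suc)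
qed

section \<open>The adjoint of multiplication by a one-row fundamental function\<close>

lemma pairing_M_qsym: "pairing a (M_qsym \<beta>) = nsym.representation (range h_comp) a (h_comp \<beta>)"
proof -
  have "pairing a (M_qsym \<beta>) = (\<Sum>\<alpha>\<in>{\<beta>}.
      nsym.representation (range h_comp) a (h_comp \<alpha>) * M_coeff (M_qsym \<beta>) \<alpha>)"
    unfolding pairing_def by (rule Sum_any.expand_superset) (auto simp: M_coeff_M split: if_splits)
  then show ?thesis by (simp add: M_coeff_M)
qed

text \<open>The functions \<open>M_qsym \<beta>\<close> read off the coordinates in the h-basis.
  This nondegeneracy gives the uniqueness needed for \<open>perp\<close>.\<close>

lemma pairing_eqI:
  assumes "\<And>g. g \<in> QSym \<Longrightarrow> pairing a g = pairing b g"
  shows "a = b"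
proof -
  let ?r = "nsym.representation (range h_comp)"
  have "?r a v = ?r b v" for v
  proof (cases "v \<in> range h_comp")
    case True
    then show ?thesis
      using assms [OF M_qsym_in_QSym] by (auto simp: pairing_M_qsym)
  next
    case False
    then show ?thesis by (metis nsym.representation_ne_zero)
  qed
  then have eq: "?r a = ?r b" ..
  have sum: "(\<Sum>v | ?r x v \<noteq> 0. nscale (?r x v) v) = x" for x
    by (rule nsym.sum_nonzero_representation_eq [OF independent_h_comp]) (simp add: span_h_comp)
  show ?thesis
    using sum [of a] sum [of b] unfolding eq by (rule trans [OF sym])
qed

text \<open>On the basis, multiplying by h_k prepends the part k, so the adjoint evaluates at lists
  with k prepended. Zero-invariance covers k = 0.\<close>

lemma coeff_pairing_h_mult:
  assumes "zero_invariant \<phi>"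
  shows "coeff_pairing (h_nsym k * a) \<phi> = coeff_pairing a (\<lambda>ks. \<phi> (k # ks))"
proof (induction a rule: nsym_induct)
  case (h_comp \<alpha>)
  have "coeff_pairing (h_nsym k * h_comp \<alpha>) \<phi> = coeff_pairing (h_list (k # parts \<alpha>)) \<phi>"
    by (simp add: h_comp_eq_h_list h_list_Cons)
  then show ?case
    by (simp add: coeff_pairing_h_list [OF assms] coeff_pairing_h_comp)
qed (simp_all add: distrib_left nscale_mult)

abbreviation perp_row :: "nat \<Rightarrow> nsym \<Rightarrow> nsym" where
  "perp_row i \<equiv> perp (F_qsym (row_comp i))"

text \<open>Coefficient functions of \<open>QSym\<close> are zero-invariant, so \<open>c\<close>
  satisfies the description that defines \<open>perp\<close>; by \<open>pairing_eqI\<close> nothing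
  else does.\<close>

lemma perp_row_eqI:
  assumes "\<And>\<phi>. zero_invariant \<phi> \<Longrightarrow> coeff_pairing c \<phi> = coeff_pairing a (conv (complete_coeff i) \<phi>)"
  shows "perp_row i a = c"
proof -
  have "coeff_fun (ps_times (F_qsym (row_comp i)) g) = conv (complete_coeff i) (coeff_fun g)" for g
    by (rule ext) (simp add: coeff_fun_ps_times coeff_fun_F_qsym_row_comp)
  then have *: "pairing c g = pairing a (ps_times (F_qsym (row_comp i)) g)" if "g \<in> QSym" for g
    using assms [OF zero_invariant_coeff_fun [OF that]] by (simp add: pairing_eq_coeff_pairing)
  show ?thesis
    unfolding perp_def
  proof (rule the_equality)
    show "\<forall>g\<in>QSym. pairing c g = pairing a (ps_times (F_qsym (row_comp i)) g)"
      using * by blast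
    fix c' assume "\<forall>g\<in>QSym. pairing c' g = pairing a (ps_times (F_qsym (row_comp i)) g)"
    then show "c' = c"
      using * by (intro pairing_eqI) metis
  qed
qed

text \<open>The complete function of degree i skews \<open>h_list ks\<close> by distributing i over
  the parts, p being removed from the first. This is the witness that the adjoint exists.\<close>

fun h_skew :: "nat \<Rightarrow> nat list \<Rightarrow> nsym" where
  "h_skew i [] = (if i = 0 then 1 else 0)"
| "h_skew i (k # ks) = (\<Sum>p\<le>min i k. h_nsym (k - p) * h_skew (i - p) ks)"

lemma coeff_pairing_h_skew:
  "zero_invariant \<phi> \<Longrightarrow> coeff_pairing (h_skew i ks) \<phi> = conv (complete_coeff i) \<phi> ks"
proof (induction ks arbitrary: i \<phi>)
  case Nil
  then show ?case by (simp add: coeff_pairing_1 complete_coeff_def)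
next
  case (Cons k ks)
  have "zero_invariant (\<lambda>qs. \<phi> (l # qs))" for l
    using Cons.prems by (rule zero_invariant_Cons)
  then have "coeff_pairing (h_skew i (k # ks)) \<phi>
      = (\<Sum>p\<le>min i k. conv (complete_coeff (i - p)) (\<lambda>qs. \<phi> ((k - p) # qs)) ks)"
    by (simp add: coeff_pairing_sum coeff_pairing_h_mult Cons)
  also have "\<dots> = (\<Sum>p\<le>min i k. conv (\<lambda>ps. complete_coeff i (p # ps)) (\<lambda>qs. \<phi> ((k - p) # qs)) ks)"
    by (intro sum.cong) (auto simp: complete_Cons)
  also have "\<dots> = conv (complete_coeff i) \<phi> (k # ks)"
    unfolding conv.simps by (intro sum.mono_neutral_left ballI)
      (auto simp: complete_Cons)
  finally show ?case .
qed

lemma perp_row_h_comp: "perp_row i (h_comp \<alpha>) = h_skew i (parts \<alpha>)"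
  by (rule perp_row_eqI) (simp add: coeff_pairing_h_skew coeff_pairing_h_comp)

lemma coeff_pairing_perp_row:
  assumes "zero_invariant \<phi>"
  shows "coeff_pairing (perp_row i a) \<phi> = coeff_pairing a (conv (complete_coeff i) \<phi>)"
proof -
  have "\<exists>c. \<forall>\<phi>. zero_invariant \<phi> \<longrightarrow> coeff_pairing c \<phi> = coeff_pairing a (conv (complete_coeff i) \<phi>)"
  proof (induction a rule: nsym_induct)
    case zero
    show ?case by (intro exI [of _ 0]) simp
  next
    case (add a b)
    then obtain c d where
      "\<forall>\<phi>. zero_invariant \<phi> \<longrightarrow> coeff_pairing c \<phi> = coeff_pairing a (conv (complete_coeff i) \<phi>)"
      "\<forall>\<phi>. zero_invariant \<phi> \<longrightarrow> coeff_pairing d \<phi> = coeff_pairing b (conv (complete_coeff i) \<phi>)"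
      by blast
    then show ?case by (intro exI [of _ "c + d"]) simp
  next
    case (scale r a)
    then obtain c where
      "\<forall>\<phi>. zero_invariant \<phi> \<longrightarrow> coeff_pairing c \<phi> = coeff_pairing a (conv (complete_coeff i) \<phi>)"
      by blast
    then show ?case by (intro exI [of _ "nscale r c"]) simp
  next
    case (h_comp \<alpha>)
    show ?case
      by (intro exI [of _ "h_skew i (parts \<alpha>)"]) (simp add: coeff_pairing_h_skew coeff_pairing_h_comp)
  qed
  then obtain c where c: "\<And>\<phi>. zero_invariant \<phi> \<Longrightarrow>
      coeff_pairing c \<phi> = coeff_pairing a (conv (complete_coeff i) \<phi>)"
    by blast
  from perp_row_eqI [OF c] c [OF assms] show ?thesis
    by (simp only:)
qed

lemma perp_row_add [simp]: "perp_row i (a + b) = perp_row i a + perp_row i b"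
  by (rule perp_row_eqI) (simp add: coeff_pairing_perp_row)

lemma perp_row_nscale [simp]: "perp_row i (nscale c a) = nscale c (perp_row i a)"
  by (rule perp_row_eqI) (simp add: coeff_pairing_perp_row)

lemma perp_row_zero [simp]: "perp_row i 0 = 0"
  by (rule perp_row_eqI) simp

lemma perp_row_0 [simp]: "perp_row 0 a = a"
proof -
  have "conv (complete_coeff 0) \<phi> = \<phi>" for \<phi>
    by (rule ext) (rule conv_unit_left)
  then show ?thesis by (intro perp_row_eqI) simp
qed

section \<open>Grading\<close>

text \<open>The compositions of n are sorted by their first part j; removing it lowers size minus
  length by j - 1, which accounts for the sign.\<close>

lemma h_nsym_recursion:
  assumes "n > 0"
  shows "h_nsym n = (\<Sum>j=1..n. (-1) ^ (j - 1) * (e_nsym (int j) * h_nsym (n - j)))"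
proof -
  let ?s = "\<lambda>\<beta>. Poly_Mapping.single \<beta> (1 :: rat)"
  let ?t = "\<lambda>n \<beta>. nscale ((-1) ^ (n - comp_len \<beta>)) (?s \<beta>)"
  have h: "h_nsym m = (\<Sum>\<beta> | comp_size \<beta> = m. ?t m \<beta>)" for m
    by (simp add: h_nsym_def prod_list_e_nsym minus_one_power_mult parts_inverse)
  have sign: "(-1) ^ (n - j - comp_len \<beta>) * (-1) ^ (j - 1) = ((-1) ^ (n - Suc (comp_len \<beta>)) :: rat)"
    if "j \<in> {1..n}" "comp_size \<beta> = n - j" for j \<beta>
  proof -
    \<comment> \<open>The truncated subtractions are exact, because a composition has no more parts
      than its size.\<close>
    have "n - Suc (comp_len \<beta>) = (n - j - comp_len \<beta>) + (j - 1)"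
      using that comp_len_le_comp_size [of \<beta>] by simp arith
    then show ?thesis by (simp only: power_add)
  qed
  have "(\<Sum>j=1..n. (-1) ^ (j - 1) * (e_nsym (int j) * h_nsym (n - j)))
      = (\<Sum>j=1..n. \<Sum>\<beta> | comp_size \<beta> = n - j. ?t n (row_comp j + \<beta>))"
  proof (intro sum.cong refl)
    fix j assume j: "j \<in> {1..n}"
    then have e: "e_nsym (int j) = ?s (row_comp j)"
      by (simp add: e_nsym_def)
    have len: "comp_len (row_comp j) = 1"
      using j by (simp add: comp_len_def)
    show "(-1) ^ (j - 1) * (e_nsym (int j) * h_nsym (n - j))
        = (\<Sum>\<beta> | comp_size \<beta> = n - j. ?t n (row_comp j + \<beta>))"
      unfolding h e sum_distrib_left
      by (intro sum.cong refl)
        (simp only: mem_Collect_eq minus_one_power_mult nscale_mult mult_single nsym.scale_scale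
          sign [OF j] comp_len_plus len plus_1_eq_Suc mult_1 One_nat_def [symmetric])
  qed
  also have "\<dots> = (\<Sum>\<beta> | comp_size \<beta> = n. ?t n \<beta>)"
    unfolding sum.Sigma [OF finite_atLeastAtMost ballI [OF finite_comp_size]]
  proof (rule sum.reindex_bij_witness
      [of _ "\<lambda>\<beta>. (hd (parts \<beta>), Composition (tl (parts \<beta>)))" "\<lambda>(j, \<beta>). row_comp j + \<beta>"])
    fix \<beta> assume \<beta>: "\<beta> \<in> {\<beta>. comp_size \<beta> = n}"
    with assms obtain j js where js: "parts \<beta> = j # js"
      by (cases "parts \<beta>") (auto simp: comp_size_def)
    with zero_notin_parts [of \<beta>] have pos: "0 \<notin> set (j # js)" by simp
    then have tl: "parts (Composition js) = js"
      by (simp add: Composition_inverse)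
    show "(hd (parts \<beta>), Composition (tl (parts \<beta>))) \<in> Sigma {1..n} (\<lambda>j. {\<beta>. comp_size \<beta> = n - j})"
      using \<beta> pos by (auto simp: comp_size_def js tl)
    show "(case (hd (parts \<beta>), Composition (tl (parts \<beta>))) of (j, \<beta>) \<Rightarrow> row_comp j + \<beta>) = \<beta>"
      using pos by (simp add: parts_inject [symmetric] js tl)
  qed (auto simp: comp_size_def parts_inverse)
  finally show ?thesis by (simp add: h)
qed

text \<open>Spanned by the h-basis rather than by words in the e_j, because \<open>perp_row\<close>
  is explicit on it. The degree will bound the sum in \<open>Brs\<close>.\<close>

definition graded :: "nat \<Rightarrow> nsym set" where
  "graded n = nsym.span (h_comp ` {\<alpha>. comp_size \<alpha> = n})"

lemma subspace_graded: "nsym.subspace (graded n)"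
  by (simp add: graded_def)

lemma h_list_in_graded: "h_list ks \<in> graded (sum_list ks)"
  unfolding graded_def h_list_eq_h_comp by (intro nsym.span_base) (simp add: comp_size_def)

lemma graded_induct [consumes 1, case_names zero add scale h_comp]:
  assumes "a \<in> graded n" "P 0" "\<And>a b. P a \<Longrightarrow> P b \<Longrightarrow> P (a + b)" "\<And>c a. P a \<Longrightarrow> P (nscale c a)"
    and "\<And>\<alpha>. comp_size \<alpha> = n \<Longrightarrow> P (h_comp \<alpha>)"
  shows "P a"
  using assms(1) unfolding graded_def
  by (rule nsym.span_induct) (auto intro: assms(2-) nsym.subspaceI)

lemma subspace_vimage_mult: "nsym.subspace S \<Longrightarrow> nsym.subspace {a. x * a \<in> S}"
  by (rule nsym.subspaceI)
    (auto simp: distrib_left nscale_mult nsym.subspace_0 nsym.subspace_add nsym.subspace_scale)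

lemma h_mult_in_graded:
  assumes "a \<in> graded n"
  shows "h_nsym k * a \<in> graded (k + n)"
  using assms
proof (induction rule: graded_induct)
  case (h_comp \<alpha>)
  then show ?case
    using h_list_in_graded [of "k # parts \<alpha>"] by (simp add: h_comp_eq_h_list h_list_Cons comp_size_def)
qed (simp_all add: distrib_left nscale_mult nsym.subspace_0 nsym.subspace_add nsym.subspace_scale subspace_graded)

text \<open>Solves \<open>h_nsym_recursion\<close> for its top term, where h_0 = 1 leaves e_k alone.
  Induction on k then transfers facts about left multiplication by h_k to e_k.\<close>

lemma e_mult_eq:
  assumes "k > 0"
  shows "e_nsym (int k) * a = nscale ((-1) ^ (k - 1))
    (h_nsym k * a - (\<Sum>j=1..<k. (-1) ^ (j - 1) * (e_nsym (int j) * (h_nsym (k - j) * a))))"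
proof -
  have "{1..k} = insert k {1..<k}"
    using assms by auto
  then have "h_nsym k * a = (-1) ^ (k - 1) * (e_nsym (int k) * a)
      + (\<Sum>j=1..<k. (-1) ^ (j - 1) * (e_nsym (int j) * (h_nsym (k - j) * a)))"
    by (simp add: h_nsym_recursion [OF assms] h_nsym_0 distrib_right sum_distrib_right mult.assoc)
  then show ?thesis
    by (simp add: minus_one_power_mult power_mult_distrib [symmetric])
qed

lemma e_mult_in_graded:
  assumes "a \<in> graded n"
  shows "e_nsym (int k) * a \<in> graded (k + n)"
  using assms
proof (induction k arbitrary: a n rule: less_induct)
  case (less k)
  show ?case
  proof (cases "k = 0")
    case False
    then have k: "k > 0" by simp
    have "e_nsym (int j) * (h_nsym (k - j) * a) \<in> graded (k + n)" if "j \<in> {1..<k}" for j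
      using less.IH [of j "h_nsym (k - j) * a" "k - j + n"] h_mult_in_graded [OF less.prems, of "k - j"] that
      by (simp add: add.assoc [symmetric])
    then show ?thesis
      using h_mult_in_graded [OF less.prems, of k]
      unfolding e_mult_eq [OF k, of a] minus_one_power_mult
      by (intro nsym.subspace_diff nsym.subspace_scale nsym.subspace_sum subspace_graded)
  qed (use less.prems in \<open>simp add: e_nsym_def\<close>)
qed

lemma h_skew_in_graded: "i \<le> sum_list ks \<Longrightarrow> h_skew i ks \<in> graded (sum_list ks - i)"
  and h_skew_eq_0: "sum_list ks < i \<Longrightarrow> h_skew i ks = 0"
proof (induction ks arbitrary: i)
  case Nil
  {
    case 1
    then show ?case using h_list_in_graded [of "[]"] by (simp add: h_list_def)
  next
    case 2
    then show ?case by simp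
  }
next
  case (Cons k ks)
  {
    case 1
    have "h_nsym (k - p) * h_skew (i - p) ks \<in> graded (k + sum_list ks - i)" if p: "p \<le> i" "p \<le> k" for p
    proof (cases "i - p \<le> sum_list ks")
      case True
      then show ?thesis
        using h_mult_in_graded [OF Cons.IH(1), of "i - p" "k - p"] p 1 by simp
    next
      case False
      then show ?thesis
        by (simp add: Cons.IH(2) nsym.subspace_0 subspace_graded)
    qed
    then show ?case
      by (auto intro!: nsym.subspace_sum subspace_graded)
  next
    case 2
    then show ?case
      by (auto intro!: sum.neutral simp: Cons.IH(2))
  }
qed

lemma perp_row_in_graded:
  assumes "a \<in> graded n" "i \<le> n"
  shows "perp_row i a \<in> graded (n - i)"
  using assms(1)
proof (induction rule: graded_induct)
  case (h_comp \<alpha>)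
  then show ?case
    using h_skew_in_graded [of i "parts \<alpha>"] assms(2) by (simp add: perp_row_h_comp comp_size_def)
qed (simp_all add: nsym.subspace_0 nsym.subspace_add nsym.subspace_scale subspace_graded)

lemma perp_row_eq_0:
  assumes "a \<in> graded n" "n < i"
  shows "perp_row i a = 0"
  using assms(1)
proof (induction rule: graded_induct)
  case (h_comp \<alpha>)
  then show ?case
    using h_skew_eq_0 [of "parts \<alpha>" i] assms(2) by (simp add: perp_row_h_comp comp_size_def)
qed simp_all

text \<open>Skewing by a degree above n kills \<open>a\<close>, so \<open>Sum_any\<close> is a
  genuine finite sum.\<close>

lemma Brs_graded:
  assumes "a \<in> graded n"
  shows "Brs m a = (\<Sum>i\<le>n. (-1) ^ i * (e_nsym (m + int i) * perp_row i a))"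
  unfolding Brs_def mult.assoc
  by (rule Sum_any.expand_superset) (auto simp: not_less [symmetric] perp_row_eq_0 [OF assms])

lemma Brs_in_graded:
  assumes "a \<in> graded n"
  shows "Brs (int k) a \<in> graded (k + n)"
proof -
  have "e_nsym (int k + int i) * perp_row i a \<in> graded (k + n)" if "i \<le> n" for i
    using e_mult_in_graded [OF perp_row_in_graded [OF assms that], of "k + i"] that by simp
  then show ?thesis
    unfolding Brs_graded [OF assms] minus_one_power_mult
    by (intro nsym.subspace_sum nsym.subspace_scale subspace_graded) simp
qed

section \<open>Spanning\<close>

definition Brs_prod :: "composition \<Rightarrow> nsym" where
  "Brs_prod \<alpha> = foldr (\<lambda>k. Brs (int k)) (parts \<alpha>) 1"

lemma Brs_prod_0 [simp]: "Brs_prod 0 = 1"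
  by (simp add: Brs_prod_def)

lemma Brs_prod_row_plus: "k > 0 \<Longrightarrow> Brs_prod (row_comp k + \<alpha>) = Brs (int k) (Brs_prod \<alpha>)"
  by (simp add: Brs_prod_def)

lemma composition_induct [case_names zero plus]:
  assumes "P 0" "\<And>k \<alpha>. k > 0 \<Longrightarrow> P \<alpha> \<Longrightarrow> P (row_comp k + \<alpha>)"
  shows "P \<alpha>"
proof -
  have "P (Composition ks)" if "0 \<notin> set ks" for ks
    using that
  proof (induction ks)
    case Nil
    then show ?case using assms(1) by (simp flip: zero_composition_def)
  next
    case (Cons k ks)
    then have "row_comp k + Composition ks = Composition (k # ks)"
      by (simp add: parts_inject [symmetric] Composition_inverse)
    with Cons show ?case using assms(2) [of k "Composition ks"] by simp
  qed
  from this [of "parts \<alpha>"] show ?thesis by (simp add: parts_inverse)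
qed

lemma Brs_prod_in_graded: "Brs_prod \<alpha> \<in> graded (comp_size \<alpha>)"
proof (induction \<alpha> rule: composition_induct)
  case zero
  show ?case using h_list_in_graded [of "[]"] by (simp add: h_list_def)
next
  case (plus k \<alpha>)
  then show ?case
    using Brs_in_graded [OF plus(2), of k] by (simp add: Brs_prod_row_plus) (simp add: comp_size_def)
qed

definition Brs_span :: "nat \<Rightarrow> nsym set" where
  "Brs_span n = nsym.span (Brs_prod ` {\<alpha>. comp_size \<alpha> = n})"

lemma subspace_Brs_span: "nsym.subspace (Brs_span n)"
  by (simp add: Brs_span_def)

text \<open>
  \<open>e\<^sub>k a\<close> is the leading term of \<open>Brs k a\<close>; all others start with some \<open>e\<^sub>j\<close> with \<open>j > k\<close>.
\<close>

lemma e_mult_in_Brs_span: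
  assumes "\<And>m. m < n \<Longrightarrow> graded m \<subseteq> Brs_span m" "0 < k" "k \<le> n" "a \<in> graded (n - k)"
  shows "e_nsym (int k) * a \<in> Brs_span n"
  using assms(2-)
proof (induction "n - k" arbitrary: k a rule: less_induct)
  case less
  \<comment> \<open>Degree n - k is below n, so by hypothesis only the elements
    \<open>Brs_prod \<alpha>\<close> need be considered.\<close>
  have "e_nsym (int k) * Brs_prod \<alpha> \<in> Brs_span n" if \<alpha>: "comp_size \<alpha> = n - k" for \<alpha>
  proof -
    let ?a = "Brs_prod \<alpha>"
    have a: "?a \<in> graded (n - k)"
      using Brs_prod_in_graded [of \<alpha>] \<alpha> by simp
    have "{..n - k} = insert 0 {1..n - k}"
      by auto
    then have "e_nsym (int k) * ?a = Brs_prod (row_comp k + \<alpha>)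
        - (\<Sum>i=1..n - k. (-1) ^ i * (e_nsym (int (k + i)) * perp_row i ?a))"
      using less.prems(1) by (simp add: Brs_prod_row_plus Brs_graded [OF a])
    moreover have "Brs_prod (row_comp k + \<alpha>) \<in> Brs_span n"
      unfolding Brs_span_def using \<alpha> less.prems by (intro nsym.span_base imageI) (auto simp: comp_size_def)
    moreover have "e_nsym (int (k + i)) * perp_row i ?a \<in> Brs_span n" if "i \<in> {1..n - k}" for i
      using that less.prems perp_row_in_graded [OF a, of i]
      by (intro less.hyps) (auto simp: diff_diff_left)
    ultimately show ?thesis
      by (auto simp: minus_one_power_mult
          intro!: nsym.subspace_diff nsym.subspace_scale nsym.subspace_sum subspace_Brs_span)
  qed
  then have "Brs_prod ` {\<alpha>. comp_size \<alpha> = n - k} \<subseteq> {a. e_nsym (int k) * a \<in> Brs_span n}"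
    by auto
  then have "Brs_span (n - k) \<subseteq> {a. e_nsym (int k) * a \<in> Brs_span n}"
    unfolding Brs_span_def [of "n - k"]
    by (rule nsym.span_minimal) (rule subspace_vimage_mult [OF subspace_Brs_span])
  moreover have "a \<in> Brs_span (n - k)"
    using assms(1) [of "n - k"] less.prems by auto
  ultimately show ?case by blast
qed

text \<open>The first factor of \<open>h_comp \<alpha>\<close> expands into terms starting with some
  e_j, j > 0. These fall under \<open>e_mult_in_Brs_span\<close>, whose hypothesis on lower degrees
  is the induction hypothesis.\<close>

lemma graded_subset_Brs_span: "graded n \<subseteq> Brs_span n"
proof (induction n rule: less_induct)
  case (less n)
  have "h_comp \<alpha> \<in> Brs_span n" if "comp_size \<alpha> = n" for \<alpha>
  proof (cases "parts \<alpha>")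
    case Nil
    then have "\<alpha> = 0"
      by (simp add: parts_inject [symmetric])
    then have "h_comp \<alpha> = Brs_prod \<alpha>"
      by (simp add: h_comp_def)
    then show ?thesis
      unfolding Brs_span_def using that by (auto intro: nsym.span_base)
  next
    case (Cons k ks)
    then have k: "0 < k" "k + sum_list ks = n"
      using that zero_notin_parts [of \<alpha>] by (auto simp: comp_size_def simp del: zero_notin_parts)
    have "h_comp \<alpha> = h_nsym k * h_list ks"
      by (simp add: h_comp_eq_h_list Cons h_list_Cons)
    also have "\<dots> = (\<Sum>j=1..k. (-1) ^ (j - 1) * (e_nsym (int j) * h_list ((k - j) # ks)))"
      by (simp add: h_nsym_recursion [OF k(1)] sum_distrib_right mult.assoc h_list_Cons)
    also have "\<dots> \<in> Brs_span n"
      unfolding minus_one_power_mult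
    proof (intro nsym.subspace_sum nsym.subspace_scale subspace_Brs_span e_mult_in_Brs_span less)
      fix j assume "j \<in> {1..k}"
      then show "0 < j" "j \<le> n" "h_list ((k - j) # ks) \<in> graded (n - j)"
        using h_list_in_graded [of "(k - j) # ks"] k(2) by auto
    qed
    finally show ?thesis .
  qed
  then show ?case
    unfolding graded_def by (intro nsym.span_minimal subspace_Brs_span) auto
qed

lemma span_Brs_prod: "nsym.span (range Brs_prod) = UNIV"
proof -
  have "h_comp \<alpha> \<in> nsym.span (range Brs_prod)" for \<alpha>
  proof -
    have "h_comp \<alpha> \<in> Brs_span (comp_size \<alpha>)"
      using subsetD [OF graded_subset_Brs_span h_list_in_graded [of "parts \<alpha>"]]
      by (simp add: h_comp_eq_h_list comp_size_def)
    moreover have "Brs_span (comp_size \<alpha>) \<subseteq> nsym.span (range Brs_prod)"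
      unfolding Brs_span_def by (rule nsym.span_mono) auto
    ultimately show ?thesis by (rule rev_subsetD)
  qed
  then have "nsym.span (range h_comp) \<subseteq> nsym.span (range Brs_prod)"
    by (intro nsym.span_minimal) auto
  then show ?thesis by (auto simp: span_h_comp)
qed

section \<open>Counting tableaux\<close>

text \<open>If x_s is the first variable with positive exponent k, one s starts the bottom row. The
  other g - 1 entries of that row give an elementary function in later variables, and k - 1 copies
  of s are left for the upper rows.\<close>

fun tableau_coeff :: "nat list \<Rightarrow> nat list \<Rightarrow> rat" where
  "tableau_coeff [] ks = complete_coeff 0 ks"
| "tableau_coeff (g # gs) [] = 0"
| "tableau_coeff (g # gs) (k # ks) =
     (if k = 0 then tableau_coeff (g # gs) ks
      else conv (elementary_coeff (g - 1)) (\<lambda>qs. tableau_coeff gs ((k - 1) # qs)) ks)"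

lemma zero_invariant_tableau_coeff: "zero_invariant (tableau_coeff gs)"
proof (induction gs)
  case Nil
  show ?case using zero_invariant_complete [of 0] by (simp add: zero_invariant_def)
next
  case (Cons g gs)
  have *: "zero_invariant (conv (elementary_coeff (g - 1)) (\<lambda>qs. tableau_coeff gs (k # qs)))" for k
    by (intro zero_invariant_conv zero_invariant_elementary zero_invariant_Cons [OF Cons])
  have "tableau_coeff (g # gs) (removeAll 0 ks) = tableau_coeff (g # gs) ks" for ks
    by (induction ks) (use * in \<open>auto simp: zero_invariant_def\<close>)
  then show ?case by (simp add: zero_invariant_def)
qed

section \<open>Enumerating a strictly increasing row together with a weighted object\<close>

definition content :: "nat list \<Rightarrow> nat \<Rightarrow>\<^sub>0 nat" where
  "content r = (\<Sum>i\<leftarrow>r. Poly_Mapping.single i 1)"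

lemma content_Nil [simp]: "content [] = 0"
  and content_Cons [simp]: "content (i # r) = Poly_Mapping.single i 1 + content r"
  and content_append [simp]: "content (r @ r') = content r + content r'"
  by (simp_all add: content_def)

lemma lookup_content: "Poly_Mapping.lookup (content r) i = count_list r i"
  by (induction r) (simp_all add: lookup_add lookup_single when_def)

lemma keys_content [simp]: "Poly_Mapping.keys (content r) = set r"
  by (auto simp: in_keys_iff lookup_content count_list_0_iff)

text \<open>Its cardinality models the product of an elementary function in x_s and later variables
  with the generating function of \<open>V\<close> under \<open>w\<close>. Later \<open>V\<close>
  consists of the tableaux formed by the upper rows.\<close>

definition row_pairs :: "'b set \<Rightarrow> ('b \<Rightarrow> nat \<Rightarrow>\<^sub>0 nat) \<Rightarrow> nat \<Rightarrow> nat \<Rightarrow> (nat \<Rightarrow>\<^sub>0 nat) \<Rightarrow> (nat list \<times> 'b) set" where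
  "row_pairs V w j s m =
     {(r, U). sorted_wrt (<) r \<and> set r \<subseteq> {s..} \<and> length r = j \<and> U \<in> V \<and> content r + w U = m}"

lemma keys_add_nat: "Poly_Mapping.keys (p + q) = Poly_Mapping.keys p \<union> Poly_Mapping.keys (q :: 'a \<Rightarrow>\<^sub>0 nat)"
  by (auto simp: in_keys_iff lookup_add)

lemma finite_row_pairs:
  assumes "\<And>A. finite A \<Longrightarrow> finite {U \<in> V. Poly_Mapping.keys (w U) \<subseteq> A}"
  shows "finite (row_pairs V w j s m)"
proof (rule finite_subset)
  show "row_pairs V w j s m \<subseteq> {r. set r \<subseteq> Poly_Mapping.keys m \<and> length r = j} \<times>
      {U \<in> V. Poly_Mapping.keys (w U) \<subseteq> Poly_Mapping.keys m}"
    by (auto simp: row_pairs_def keys_add_nat)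
  show "finite ({r. set r \<subseteq> Poly_Mapping.keys m \<and> length r = j} \<times>
      {U \<in> V. Poly_Mapping.keys (w U) \<subseteq> Poly_Mapping.keys m})"
    by (intro finite_cartesian_product finite_lists_length_eq assms finite_keys)
qed

lemma single_add_eq_iff_minus:
  fixes p m :: "nat \<Rightarrow>\<^sub>0 nat"
  assumes "Poly_Mapping.lookup m s \<noteq> 0"
  shows "Poly_Mapping.single s 1 + p = m \<longleftrightarrow> p = m - Poly_Mapping.single s 1"
proof -
  have "Poly_Mapping.single s 1 + (m - Poly_Mapping.single s 1) = m"
    using assms by (intro poly_mapping_eqI) (auto simp: lookup_add lookup_minus lookup_single when_def)
  then show ?thesis by auto
qed

text \<open>The row either avoids s or starts with it, as it increases strictly and has no smaller
  entry. The two cases match the two terms of \<open>conv_elementary_Cons\<close>.\<close>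

lemma row_pairs_split:
  "row_pairs V w j s m = row_pairs V w j (Suc s) m \<union>
     (if Poly_Mapping.lookup m s = 0 \<or> j = 0 then {}
      else (\<lambda>(r, U). (s # r, U)) ` row_pairs V w (j - 1) (Suc s) (m - Poly_Mapping.single s 1))"
    (is "?L = ?A \<union> ?B")
proof (intro equalityI subsetI)
  fix x assume "x \<in> ?L"
  then obtain r U where x: "x = (r, U)" and r: "sorted_wrt (<) r" "set r \<subseteq> {s..}" "length r = j"
    "U \<in> V" "content r + w U = m"
    by (auto simp: row_pairs_def)
  show "x \<in> ?A \<union> ?B"
  proof (cases "s \<in> set r")
    case False
    with r have "set r \<subseteq> {Suc s..}"
      by (auto simp: Suc_le_eq order_le_less)
    with r x show ?thesis by (auto simp: row_pairs_def)
  next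
    case True
    then obtain a r' where "r = a # r'"
      by (cases r) auto
    moreover from this True r have "a \<le> s" "s \<le> a"
      by auto
    ultimately have r': "r = s # r'"
      by simp
    have m: "Poly_Mapping.single s 1 + (content r' + w U) = m"
      using r(5) by (simp add: r' add.assoc)
    then have lookup: "Poly_Mapping.lookup m s \<noteq> 0"
      by (auto simp: lookup_add)
    have "set r' \<subseteq> {Suc s..}"
      using r(1) by (auto simp: r' Suc_le_eq)
    moreover have "content r' + w U = m - Poly_Mapping.single s 1"
      using m by (simp only: single_add_eq_iff_minus [OF lookup])
    ultimately have "(r', U) \<in> row_pairs V w (j - 1) (Suc s) (m - Poly_Mapping.single s 1)"
      using r(1,3,4) by (auto simp: row_pairs_def r')
    then have "x \<in> (\<lambda>(r, U). (s # r, U)) ` row_pairs V w (j - 1) (Suc s) (m - Poly_Mapping.single s 1)"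
      unfolding x r' by (rule rev_image_eqI) simp
    moreover have "j \<noteq> 0"
      using r(3) r' by auto
    ultimately show ?thesis
      using lookup by simp
  qed
next
  fix x assume "x \<in> ?A \<union> ?B"
  then show "x \<in> ?L"
  proof
    assume "x \<in> ?A"
    then show ?thesis by (auto simp: row_pairs_def)
  next
    assume x: "x \<in> ?B"
    then have m: "Poly_Mapping.lookup m s \<noteq> 0" "j \<noteq> 0"
      by (auto split: if_splits)
    with x obtain r U where "x = (s # r, U)" and r: "sorted_wrt (<) r" "set r \<subseteq> {Suc s..}" "length r = j - 1"
      "U \<in> V" "content r + w U = m - Poly_Mapping.single s 1"
      by (auto simp: row_pairs_def)
    moreover from r(5) have "Poly_Mapping.single s 1 + (content r + w U) = m"
      by (simp only: single_add_eq_iff_minus [OF m(1)])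
    ultimately show ?thesis
      using m by (auto simp: row_pairs_def add.assoc Suc_le_eq)
  qed
qed

lemma card_row_pairs_split:
  assumes "\<And>A. finite A \<Longrightarrow> finite {U \<in> V. Poly_Mapping.keys (w U) \<subseteq> A}"
  shows "card (row_pairs V w j s m) = card (row_pairs V w j (Suc s) m) +
     (if Poly_Mapping.lookup m s = 0 \<or> j = 0 then 0
      else card (row_pairs V w (j - 1) (Suc s) (m - Poly_Mapping.single s 1)))"
proof -
  let ?A = "row_pairs V w j (Suc s) m"
    and ?B = "row_pairs V w (j - 1) (Suc s) (m - Poly_Mapping.single s 1)"
  let ?f = "\<lambda>(r, U). (s # r, U)"
  have "inj_on ?f ?B"
    by (rule inj_onI) (simp add: split_beta prod_eq_iff)
  then have "card (?f ` ?B) = card ?B"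
    by (rule card_image)
  moreover have "?A \<inter> ?f ` ?B = {}"
  proof -
    have "set (fst x) \<subseteq> {Suc s..}" if "x \<in> ?A" for x
      using that by (simp add: row_pairs_def split_beta)
    then have "s \<notin> set (fst x)" if "x \<in> ?A" for x
      using that by fastforce
    moreover have "s \<in> set (fst x)" if "x \<in> ?f ` ?B" for x
      using that by (elim imageE) (simp add: split_beta)
    ultimately show ?thesis by blast
  qed
  moreover have "finite ?A" "finite ?B"
    using assms by (auto intro: finite_row_pairs)
  ultimately have "card (?A \<union> ?f ` ?B) = card ?A + card ?B"
    by (simp add: card_Un_disjoint)
  then show ?thesis
    using row_pairs_split [of V w j s m]
    by (cases "Poly_Mapping.lookup m s = 0 \<or> j = 0")
      (simp_all only: if_True if_False Un_empty_right add_0_right)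
qed

text \<open>The list is consumed from x_s on, while \<open>c\<close> accumulates the exponents of
  the variables already passed. The row can no longer use these, so they must come from the weight
  of \<open>U\<close>.\<close>

lemma conv_elementary_card:
  assumes fin: "\<And>A. finite A \<Longrightarrow> finite {U \<in> V. Poly_Mapping.keys (w U) \<subseteq> A}"
    and "Poly_Mapping.keys c \<subseteq> {..<s}"
  shows "conv (elementary_coeff j) (\<lambda>qs. of_nat (card {U \<in> V. w U = c + monom_at [s..<s + length qs] qs})) ks
    = of_nat (card (row_pairs V w j s (c + monom_at [s..<s + length ks] ks)))"
  using assms(2)
proof (induction ks arbitrary: c s j)
  case Nil
  show ?case
  proof (cases "j = 0")
    case True
    then have "row_pairs V w j s c = Pair [] ` {U \<in> V. w U = c}"
      by (auto simp: row_pairs_def)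
    then show ?thesis
      using True by (simp add: elementary_coeff_def card_image inj_on_def)
  next
    case False
    \<comment> \<open>A nonempty row has an entry \<ge> s, whereas \<open>c\<close> involves only
      variables below s.\<close>
    have "row_pairs V w j s c = {}"
    proof (rule ccontr)
      assume "row_pairs V w j s c \<noteq> {}"
      then obtain r U where r: "set r \<subseteq> {s..}" "length r = j" "content r + w U = c"
        by (auto simp: row_pairs_def)
      then have "set r \<subseteq> Poly_Mapping.keys c"
        using keys_add_nat [of "content r" "w U"] by auto
      with r Nil False show False by (cases r) force+
    qed
    then show ?thesis
      using False by (simp add: elementary_coeff_def)
  qed
next
  case (Cons k ks)
  let ?m = "\<lambda>ks. monom_at [Suc s..<Suc s + length ks] ks"
  let ?x = "\<lambda>k ks. c + (Poly_Mapping.single s k + ?m ks)"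
  have keys: "Poly_Mapping.keys (c + Poly_Mapping.single s l) \<subseteq> {..<Suc s}" for l
    using Cons.prems by (auto simp: keys_add_nat split: if_splits)
  have IH: "conv (elementary_coeff i) (\<lambda>qs. of_nat (card {U \<in> V. w U = ?x l qs})) ks
      = of_nat (card (row_pairs V w i (Suc s) (?x l ks)))" for i l
    using Cons.IH [OF keys] by (simp add: add.assoc)
  have "Poly_Mapping.lookup c s = 0"
    using Cons.prems by (auto simp: in_keys_iff)
  then have lookup: "Poly_Mapping.lookup (?x k ks) s = k"
    using monom_at_upt_lookup_0 [of s "Suc s" ks] by (simp add: lookup_add del: upt_Suc)
  have minus: "?x k ks - Poly_Mapping.single s 1 = ?x (k - 1) ks" if "k \<noteq> 0"
    using that by (intro poly_mapping_eqI) (auto simp: lookup_add lookup_minus lookup_single when_def)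
  have "card (row_pairs V w j s m) = card (row_pairs V w j (Suc s) m) +
     (if Poly_Mapping.lookup m s = 0 \<or> j = 0 then 0
      else card (row_pairs V w (j - 1) (Suc s) (m - Poly_Mapping.single s 1)))" for m
    by (rule card_row_pairs_split) (rule fin)
  from this [of "?x k ks"] have "card (row_pairs V w j s (?x k ks)) = card (row_pairs V w j (Suc s) (?x k ks)) +
      (if k = 0 \<or> j = 0 then 0 else card (row_pairs V w (j - 1) (Suc s) (?x (k - 1) ks)))"
    unfolding lookup by (cases "k = 0") (simp_all only: minus simp_thms if_True)
  then show ?case
    unfolding conv_elementary_Cons monom_at_upt_Cons IH by (simp del: upt_Suc)
qed

text \<open>The shape is a plain list so that the recursion can drop its first part; on
  \<open>parts \<alpha>\<close> this is \<open>row_strict_immaculate_tableau\<close>.\<close>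

definition is_tableau :: "nat list \<Rightarrow> nat list list \<Rightarrow> bool" where
  "is_tableau gs U \<longleftrightarrow> map length U = gs \<and>
     (\<forall>r\<in>set U. 0 \<notin> set r \<and> sorted_wrt (<) r) \<and> sorted_wrt (\<le>) (map hd U)"

lemma finite_tableaux:
  assumes "finite A"
  shows "finite {U \<in> Collect (is_tableau gs). Poly_Mapping.keys (content (concat U)) \<subseteq> A}"
proof (rule finite_subset)
  let ?R = "{r. set r \<subseteq> A \<and> length r \<le> sum_list gs}"
  show "{U \<in> Collect (is_tableau gs). Poly_Mapping.keys (content (concat U)) \<subseteq> A}
      \<subseteq> {U. set U \<subseteq> ?R \<and> length U = length gs}"
    by (auto simp: is_tableau_def intro: member_le_sum_list)
  show "finite {U. set U \<subseteq> ?R \<and> length U = length gs}"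
    by (intro finite_lists_length_eq finite_lists_length_le assms)
qed

text \<open>If \<open>s\<close> is the smallest entry of a tableau, it is the first entry of the bottom row,
  and the remainder of that row is subject only to strictness.\<close>

lemma tableaux_Cons:
  assumes "0 \<notin> set (g # gs)" "0 < s" "Poly_Mapping.lookup m s \<noteq> 0" "Poly_Mapping.keys m \<subseteq> {s..}"
  shows "{U. is_tableau (g # gs) U \<and> content (concat U) = m} =
    (\<lambda>(r, U). (s # r) # U) ` row_pairs (Collect (is_tableau gs)) (content \<circ> concat) (g - 1) (Suc s)
      (m - Poly_Mapping.single s 1)" (is "?L = ?R")
proof (intro equalityI subsetI)
  fix U assume "U \<in> ?L"
  then have U: "is_tableau (g # gs) U" and m: "content (concat U) = m"
    by auto
  from U obtain r U' where r: "U = r # U'" "length r = g" "sorted_wrt (<) r" "is_tableau gs U'"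
    "\<And>r'. r' \<in> set U' \<Longrightarrow> hd r \<le> hd r'"
    by (cases U) (auto simp: is_tableau_def)
  have entries: "set (concat U) = Poly_Mapping.keys m"
    using m keys_content by metis
  with assms(3) have "s \<in> set (concat U)"
    by (simp only: in_keys_iff not_False_eq_True)
  then obtain r0 where r0: "r0 \<in> set U" "s \<in> set r0"
    by auto
  with U have "sorted_wrt (<) r0"
    by (auto simp: is_tableau_def)
  with r0(2) have "hd r0 \<le> s"
    by (cases r0) auto
  \<comment> \<open>The leftmost column increases weakly upwards, so
    \<open>hd r \<le> hd r0\<close>.\<close>
  with r0 r have "hd r \<le> s"
    by (cases "r0 = r") fastforce+
  moreover from r(2) assms(1) have "r \<noteq> []"
    by auto
  moreover from this have "hd r \<in> {s..}"
    using entries assms(4) r(1) by auto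
  ultimately obtain r' where r': "r = s # r'"
    by (cases r) auto
  have "Poly_Mapping.single s 1 + (content r' + content (concat U')) = m"
    using m r(1) r' by (simp add: add.assoc)
  then have "content r' + content (concat U') = m - Poly_Mapping.single s 1"
    by (simp only: single_add_eq_iff_minus [OF assms(3)])
  with r r' have "(r', U') \<in> row_pairs (Collect (is_tableau gs)) (content \<circ> concat) (g - 1) (Suc s)
      (m - Poly_Mapping.single s 1)"
    by (auto simp: row_pairs_def Suc_le_eq)
  then show "U \<in> ?R"
    using r(1) r' by force
next
  fix U assume "U \<in> ?R"
  then obtain r U' where U: "U = (s # r) # U'" and r: "sorted_wrt (<) r" "set r \<subseteq> {Suc s..}"
    "length r = g - 1" "is_tableau gs U'" "content r + content (concat U') = m - Poly_Mapping.single s 1"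
    by (auto simp: row_pairs_def)
  have m: "Poly_Mapping.single s 1 + (content r + content (concat U')) = m"
    using r(5) by (simp only: single_add_eq_iff_minus [OF assms(3)])
  then have "set (concat U') \<subseteq> Poly_Mapping.keys m"
    by (metis Un_upper2 keys_add_nat keys_content le_supI2)
  with assms(4) have "set (concat U') \<subseteq> {s..}"
    by (rule subset_trans [rotated])
  moreover have "r' \<noteq> []" if "r' \<in> set U'" for r'
    using r(4) assms(1) that by (auto simp: is_tableau_def)
  ultimately have "s \<le> hd r'" if "r' \<in> set U'" for r'
    using that by (force simp: subset_iff)
  with r U assms(1,2) m show "U \<in> ?L"
    by (auto simp: is_tableau_def Suc_le_eq add.assoc)
qed

lemma monom_at_upt_eq_0_iff: "monom_at [s..<s + length ks] ks = 0 \<longleftrightarrow> sum_list ks = 0"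
proof (induction ks arbitrary: s)
  case (Cons k ks)
  have "p + q = 0 \<longleftrightarrow> p = 0 \<and> q = 0" for p q :: "nat \<Rightarrow>\<^sub>0 nat"
    by (auto simp: poly_mapping_eq_iff lookup_add fun_eq_iff)
  moreover have "Poly_Mapping.single s k = 0 \<longleftrightarrow> k = 0"
    by (metis lookup_single_eq lookup_zero single_zero)
  ultimately show ?case
    by (simp only: monom_at_upt_Cons Cons) (simp del: sum_list_eq_0_iff)
qed simp

text \<open>The outer induction removes the bottom row, the inner one skips variables with exponent
  0. The start index is general because skipping moves it on, and positive because entries
  are.\<close>

lemma card_tableaux:
  assumes "0 \<notin> set gs" "0 < s"
  shows "of_nat (card {U. is_tableau gs U \<and> content (concat U) = monom_at [s..<s + length ks] ks})
    = tableau_coeff gs ks"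
  using assms
proof (induction gs arbitrary: s ks)
  case Nil
  have "{U. is_tableau [] U \<and> content (concat U) = monom_at [s..<s + length ks] ks}
      = (if sum_list ks = 0 then {[]} else {})"
    using monom_at_upt_eq_0_iff [of s ks] by (auto simp: is_tableau_def simp del: sum_list_eq_0_iff)
  then show ?case by (simp add: complete_coeff_def)
next
  case (Cons g gs)
  show ?case
    using Cons.prems(2)
  proof (induction ks arbitrary: s)
    case Nil
    have "{U. is_tableau (g # gs) U \<and> content (concat U) = 0} = {}"
    proof (rule ccontr)
      assume "{U. is_tableau (g # gs) U \<and> content (concat U) = 0} \<noteq> {}"
      then obtain U where U: "is_tableau (g # gs) U" "content (concat U) = 0"
        by auto
      then have "set (concat U) = {}"
        by (metis keys_content keys_zero)
      with U(1) Cons.prems(1) show False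
        by (cases U) (auto simp: is_tableau_def)
    qed
    then show ?case by (simp only: list.size upt_conv_Nil monom_at_Nil) simp
  next
    case inner: (Cons k ks)
    show ?case
    proof (cases "k = 0")
      case True
      then show ?thesis
        using inner.IH [of "Suc s"] unfolding monom_at_upt_Cons by simp
    next
      case False
      let ?m = "Poly_Mapping.single s k + monom_at [Suc s..<Suc s + length ks] ks"
      let ?V = "Collect (is_tableau gs)"
      have keys: "Poly_Mapping.keys ?m \<subseteq> {s..}"
        using keys_monom_at_subset [of "[Suc s..<Suc s + length ks]" ks]
        by (auto simp: keys_add_nat simp del: upt_Suc split: if_splits)
      have lookup: "Poly_Mapping.lookup ?m s \<noteq> 0"
        using False by (simp add: lookup_add)
      have minus: "?m - Poly_Mapping.single s 1
          = Poly_Mapping.single s (k - 1) + monom_at [Suc s..<Suc s + length ks] ks"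
        using False by (intro poly_mapping_eqI) (auto simp: lookup_add lookup_minus lookup_single when_def)
      have "of_nat (card {U. is_tableau (g # gs) U \<and> content (concat U) = ?m})
          = (of_nat (card (row_pairs ?V (content \<circ> concat) (g - 1) (Suc s) (?m - Poly_Mapping.single s 1))) :: rat)"
        unfolding tableaux_Cons [OF Cons.prems(1) inner.prems lookup keys]
        by (subst card_image) (auto simp: inj_on_def)
      \<comment> \<open>The k - 1 remaining copies of s play the role of exponents already passed,
        so only the upper rows can contain them.\<close>
      also have "\<dots> = conv (elementary_coeff (g - 1)) (\<lambda>qs. of_nat (card {U \<in> ?V. (content \<circ> concat) U =
          Poly_Mapping.single s (k - 1) + monom_at [Suc s..<Suc s + length qs] qs})) ks"
        unfolding minus
        by (rule conv_elementary_card [symmetric]) (use finite_tableaux in \<open>auto split: if_splits\<close>)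
      also have "\<dots> = tableau_coeff (g # gs) (k # ks)"
        using Cons.IH [of s "(k - 1) # _"] Cons.prems(1) inner.prems False
        unfolding monom_at_upt_Cons by simp
      finally show ?thesis unfolding monom_at_upt_Cons .
    qed
  qed
qed

lemma coeff_fun_RS_dual: "coeff_fun (RS_dual \<beta>) = tableau_coeff (parts \<beta>)"
proof
  fix ks
  have "coeff_fun (RS_dual \<beta>) ks =
      of_nat (card {U. is_tableau (parts \<beta>) U \<and> content (concat U) = monom_at [1..<1 + length ks] ks})"
    by (simp add: coeff_fun_def RS_dual_def row_strict_immaculate_tableau_def is_tableau_def
        tableau_content_def content_def del: upt_Suc)
  then show "coeff_fun (RS_dual \<beta>) ks = tableau_coeff (parts \<beta>) ks"
    by (simp only: card_tableaux zero_notin_parts not_False_eq_True zero_less_one)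
qed

section \<open>Orthogonality\<close>

lemma coeff_pairing_add_right:
  "coeff_pairing a (\<lambda>ks. \<phi> ks + \<psi> ks) = coeff_pairing a \<phi> + coeff_pairing a \<psi>"
  by (induction a rule: nsym_induct) (simp_all add: coeff_pairing_h_comp distrib_left)

lemma coeff_pairing_zero_right [simp]: "coeff_pairing a (\<lambda>ks. 0) = 0"
  by (induction a rule: nsym_induct) (simp_all add: coeff_pairing_h_comp)

section \<open>The adjoint of left multiplication by e_k\<close>

lemma coeff_pairing_e_mult:
  assumes "k > 0"
  shows "coeff_pairing (e_nsym (int k) * a) \<phi> = (-1) ^ (k - 1) *
    (coeff_pairing (h_nsym k * a) \<phi>
      - (\<Sum>j=1..<k. (-1) ^ (j - 1) * coeff_pairing (e_nsym (int j) * (h_nsym (k - j) * a)) \<phi>))"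
proof -
  have "coeff_pairing (x - y) \<phi> = coeff_pairing x \<phi> - coeff_pairing y \<phi>" for x y
    using coeff_pairing_add [of "x - y" y \<phi>] by simp
  then show ?thesis
    unfolding e_mult_eq [OF assms, of a] by (simp add: coeff_pairing_sum)
qed

lemma coeff_pairing_e_mult_tableau_Nil:
  "k > 0 \<Longrightarrow> coeff_pairing (e_nsym (int k) * a) (tableau_coeff []) = 0"
proof (induction k arbitrary: a rule: less_induct)
  case (less k)
  have "(\<lambda>ks. tableau_coeff [] (k # ks)) = (\<lambda>ks. 0)"
    using less.prems by (simp add: complete_coeff_def)
  then have "coeff_pairing (h_nsym k * a) (tableau_coeff []) = 0"
    by (simp only: coeff_pairing_h_mult [OF zero_invariant_tableau_coeff] coeff_pairing_zero_right)
  then show ?case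
    by (simp add: coeff_pairing_e_mult [OF less.prems] less.IH del: tableau_coeff.simps)
qed

text \<open>Only the adjoint of h_m is direct: it prepends m. After expanding e_k by
  \<open>e_mult_eq\<close>, each term with j < k splits by \<open>conv_elementary_Cons\<close> into
  two pieces that cancel against those of the neighbouring terms; one piece survives.\<close>

lemma coeff_pairing_e_mult_tableau_Cons:
  assumes "k > 0" "g > 0"
  shows "coeff_pairing (e_nsym (int k) * a) (tableau_coeff (g # gs)) =
    (if k \<le> g then coeff_pairing a (conv (elementary_coeff (g - k)) (tableau_coeff gs)) else 0)"
  using assms(1)
proof (induction k arbitrary: a rule: less_induct)
  case (less k)
  let ?T = "tableau_coeff (g # gs)"
  \<comment> \<open>\<open>Q j m\<close> is the part of the product with the elementary function of
    degree g - j in which all m factors of the first variable come from the upper rows.\<close>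
  define Q where "Q j m ks = (if j \<le> g then conv (elementary_coeff (g - j)) (\<lambda>qs. tableau_coeff gs (m # qs)) ks else 0)"
    for j m ks
  have h: "coeff_pairing (h_nsym k * a) ?T = coeff_pairing a (Q 1 (k - 1))"
  proof -
    have "(\<lambda>ks. ?T (k # ks)) = Q 1 (k - 1)"
      using less.prems assms(2) by (simp add: Q_def [abs_def])
    then show ?thesis
      by (simp only: coeff_pairing_h_mult [OF zero_invariant_tableau_coeff])
  qed
  \<comment> \<open>At j = g the elementary factor is constant and takes nothing, in agreement with
    \<open>Q (Suc g)\<close> being 0.\<close>
  have split: "(if j \<le> g then conv (elementary_coeff (g - j)) (tableau_coeff gs) (m # ks) else 0)
      = Q j m ks + Q (Suc j) (m - 1) ks" if "m > 0" for j m ks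
    using that by (auto simp: Q_def conv_elementary_Cons simp del: conv.simps)
  have step: "coeff_pairing (e_nsym (int j) * (h_nsym (k - j) * a)) ?T
      = coeff_pairing a (Q j (k - j)) + coeff_pairing a (Q (Suc j) (k - Suc j))" if j: "j \<in> {1..<k}" for j
  proof -
    have "coeff_pairing (e_nsym (int j) * (h_nsym (k - j) * a)) ?T =
        (if j \<le> g then coeff_pairing a (\<lambda>ks. conv (elementary_coeff (g - j)) (tableau_coeff gs) ((k - j) # ks)) else 0)"
      using j by (subst less.IH) (auto simp: coeff_pairing_h_mult zero_invariant_conv
          zero_invariant_elementary zero_invariant_tableau_coeff simp del: conv.simps)
    also have "\<dots> = coeff_pairing a
        (\<lambda>ks. if j \<le> g then conv (elementary_coeff (g - j)) (tableau_coeff gs) ((k - j) # ks) else 0)"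
      by simp
    also have "\<dots> = coeff_pairing a (\<lambda>ks. Q j (k - j) ks + Q (Suc j) (k - Suc j) ks)"
      using split [of "k - j"] j by simp
    finally show ?thesis by (simp only: coeff_pairing_add_right)
  qed
  \<comment> \<open>By \<open>step\<close>, the recursion for \<open>h\<^sub>k\<close> in terms of the \<open>e\<^sub>j\<close> telescopes.\<close>
  define c where "c j = - ((-1) ^ (j - 1) * coeff_pairing a (Q j (k - j)))" for j
  have "(\<Sum>j=1..<k. (-1) ^ (j - 1) * coeff_pairing (e_nsym (int j) * (h_nsym (k - j) * a)) ?T)
      = (\<Sum>j=1..<k. c (Suc j) - c j)"
  proof (intro sum.cong refl)
    fix j assume j: "j \<in> {1..<k}"
    then obtain i where "j = Suc i" by (cases j) auto
    then show "(-1) ^ (j - 1) * coeff_pairing (e_nsym (int j) * (h_nsym (k - j) * a)) ?T = c (Suc j) - c j"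
      unfolding step [OF j] c_def by (simp add: distrib_left)
  qed
  also have "\<dots> = c k - c 1"
    using less.prems by (intro sum_Suc_diff') simp
  finally have "coeff_pairing (e_nsym (int k) * a) ?T = (-1) ^ (k - 1) * - c k"
    by (simp add: coeff_pairing_e_mult [OF less.prems] h c_def)
  also have "\<dots> = coeff_pairing a (Q k 0)"
    by (simp add: c_def power_mult_distrib [symmetric] mult.assoc [symmetric])
  \<comment> \<open>An exponent 0 of the first variable may be dropped by zero-invariance.\<close>
  also have "Q k 0 = (\<lambda>ks. if k \<le> g then conv (elementary_coeff (g - k)) (tableau_coeff gs) ks else 0)"
    by (auto simp: Q_def fun_eq_iff zero_invariant_Cons_0 [OF zero_invariant_tableau_coeff])
  finally show ?case by simp
qed

section \<open>Duality between iterated operators and tableau functions\<close>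

lemma coeff_pairing_Brs_Nil:
  assumes "a \<in> graded n" "k > 0"
  shows "coeff_pairing (Brs (int k) a) (tableau_coeff []) = 0"
  using assms coeff_pairing_e_mult_tableau_Nil [of "k + _"]
  by (simp add: Brs_graded coeff_pairing_sum)

lemma coeff_pairing_Brs_Cons:
  assumes "a \<in> graded n" "k > 0" "g > 0"
  shows "coeff_pairing (Brs (int k) a) (tableau_coeff (g # gs)) =
    (if k = g then coeff_pairing a (tableau_coeff gs) else 0)"
proof -
  let ?T = "tableau_coeff gs"
  define F where "F i = (-1) ^ i * coeff_pairing (e_nsym (int k + int i) * perp_row i a) (tableau_coeff (g # gs))" for i
  have F: "F i = (if k + i \<le> g
      then (-1) ^ i * coeff_pairing a (conv (conv (complete_coeff i) (elementary_coeff (g - (k + i)))) ?T) else 0)" for i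
  proof -
    \<comment> \<open>Associativity isolates the product of a complete and an elementary function,
      to which \<open>alternating_sum_conv\<close> will apply.\<close>
    have "conv (complete_coeff i) (conv (elementary_coeff (g - (k + i))) ?T)
        = conv (conv (complete_coeff i) (elementary_coeff (g - (k + i)))) ?T"
      by (rule ext) (simp only: conv_assoc)
    then show ?thesis
      using coeff_pairing_e_mult_tableau_Cons [of "k + i" g "perp_row i a" gs] assms(2,3)
      by (simp add: F_def coeff_pairing_perp_row zero_invariant_conv zero_invariant_elementary
          zero_invariant_tableau_coeff)
  qed
  have F_0: "F i = 0" if "i > n" for i
    using perp_row_eq_0 [OF assms(1) that] by (simp add: F_def)
  have Brs: "coeff_pairing (Brs (int k) a) (tableau_coeff (g # gs)) = (\<Sum>i\<le>n. F i)"
    by (simp add: Brs_graded [OF assms(1)] coeff_pairing_sum F_def)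
  show ?thesis
  proof (cases "k \<le> g")
    case False
    then show ?thesis by (simp add: Brs F)
  next
    case True
    let ?d = "g - k"
    \<comment> \<open>Terms vanish above n because \<open>perp_row\<close> kills \<open>a\<close>,
      and above g - k because the elementary degree would be negative. Passing through the maximum
      replaces one bound by the other.\<close>
    have "(\<Sum>i\<le>n. F i) = (\<Sum>i\<le>max n ?d. F i)"
      by (intro sum.mono_neutral_left) (auto simp: F_0)
    also have "\<dots> = (\<Sum>i\<le>?d. F i)"
      using True by (intro sum.mono_neutral_right) (auto simp: F)
    also have "\<dots> = (\<Sum>i\<le>?d. (-1) ^ i * coeff_pairing a (conv (conv (complete_coeff i) (elementary_coeff (?d - i))) ?T))"
      using True by (intro sum.cong) (auto simp: F)
    also have "\<dots> = coeff_pairing a (\<lambda>ks. \<Sum>i\<le>?d. (-1) ^ i *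
        conv (conv (complete_coeff i) (elementary_coeff (?d - i))) ?T ks)"
      by (rule coeff_pairing_sum_right [symmetric])
    also have "\<dots> = coeff_pairing a (conv (\<lambda>ks. if ?d = 0 then complete_coeff 0 ks else 0) ?T)"
      unfolding conv_sum_left [symmetric] alternating_sum_conv ..
    also have "\<dots> = (if k = g then coeff_pairing a ?T else 0)"
    proof -
      have "conv (complete_coeff 0) ?T = ?T"
        by (rule ext) (rule conv_unit_left)
      moreover have "conv (\<lambda>ks. 0) ?T = (\<lambda>ks. 0)"
        by (rule ext) simp
      ultimately show ?thesis
        using True by (cases "k = g") simp_all
    qed
    finally show ?thesis unfolding Brs .
  qed
qed

text \<open>Each \<open>Brs\<close> strips the first part of \<beta> if it equals that of \<alpha>
  and gives 0 otherwise, so \<beta> has to vary in the induction.\<close>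

lemma pairing_Brs_prod_RS_dual:
  "pairing (Brs_prod \<alpha>) (RS_dual \<beta>) = (if \<alpha> = \<beta> then 1 else 0)"
proof -
  have "coeff_pairing (Brs_prod \<alpha>) (tableau_coeff (parts \<beta>)) = (if parts \<alpha> = parts \<beta> then 1 else 0)"
  proof (induction \<alpha> arbitrary: \<beta> rule: composition_induct)
    case zero
    have "tableau_coeff [] [] = 1"
      by (simp add: complete_coeff_def)
    then show ?case
      by (cases "parts \<beta>")
        (simp_all add: coeff_pairing_1 zero_invariant_tableau_coeff del: tableau_coeff.simps(1))
  next
    case (plus k \<alpha>)
    show ?case
    proof (cases "parts \<beta>")
      case Nil
      then show ?thesis
        using plus(1) by (simp add: Brs_prod_row_plus coeff_pairing_Brs_Nil [OF Brs_prod_in_graded]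
            del: tableau_coeff.simps)
    next
      case (Cons g gs)
      with zero_notin_parts [of \<beta>] have g: "g > 0" "parts (Composition gs) = gs"
        by (auto simp: Composition_inverse simp del: zero_notin_parts)
      then show ?thesis
        using plus(1) plus(2) [of "Composition gs"]
        by (simp add: Cons Brs_prod_row_plus coeff_pairing_Brs_Cons [OF Brs_prod_in_graded])
    qed
  qed
  then show ?thesis
    by (simp add: pairing_eq_coeff_pairing coeff_fun_RS_dual parts_inject)
qed

text \<open>In an expansion of \<open>a\<close> in the spanning elements
  \<open>Brs_prod \<beta>\<close>, pairing with \<open>RS_dual \<beta>\<close> reads off a
  coefficient. This is the uniqueness needed for the description defining \<open>RS\<close>.\<close>

lemma RS_dual_separates:
  assumes "\<And>\<beta>. pairing a (RS_dual \<beta>) = 0"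
  shows "a = 0"
proof -
  have "a \<in> nsym.span (range Brs_prod)"
    by (simp add: span_Brs_prod)
  then obtain t r where t: "finite t" "t \<subseteq> range Brs_prod" and a: "a = (\<Sum>v\<in>t. nscale (r v) v)"
    unfolding nsym.span_explicit by blast
  have "r v = 0" if v_t: "v \<in> t" for v
  proof -
    obtain \<beta> where v: "v = Brs_prod \<beta>"
      using v_t t(2) by blast
    \<comment> \<open>The set \<open>t\<close> consists of vectors, not indices; orthogonality also
      shows that distinct indices give distinct vectors, so comparing with \<open>v\<close> detects
      the index.\<close>
    have "coeff_pairing (Brs_prod \<gamma>) (coeff_fun (RS_dual \<beta>)) = (if Brs_prod \<gamma> = v then 1 else 0)" for \<gamma>
      using pairing_Brs_prod_RS_dual [of \<gamma> \<beta>] pairing_Brs_prod_RS_dual [of \<beta> \<beta>]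
      by (cases "\<gamma> = \<beta>") (auto simp: v pairing_eq_coeff_pairing)
    then have "coeff_pairing w (coeff_fun (RS_dual \<beta>)) = (if w = v then 1 else 0)" if "w \<in> t" for w
      using that t(2) by auto
    then have "pairing a (RS_dual \<beta>) = (\<Sum>w\<in>t. if w = v then r w else 0)"
      unfolding a pairing_eq_coeff_pairing coeff_pairing_sum by (intro sum.cong) simp_all
    then show ?thesis
      using assms t(1) v_t by simp
  qed
  then show ?thesis by (simp add: a)
qed

theorem theorem3p17:
  fixes \<alpha> :: composition
  shows "RS \<alpha> = foldr (\<lambda>k. Brs (int k)) (parts \<alpha>) 1"
proof -
  have "RS \<alpha> = Brs_prod \<alpha>"
    unfolding RS_def
  proof (rule the_equality)
    show "\<forall>\<beta>. pairing (Brs_prod \<alpha>) (RS_dual \<beta>) = (if \<alpha> = \<beta> then 1 else 0)"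
      by (simp add: pairing_Brs_prod_RS_dual)
  next
    fix a assume "\<forall>\<beta>. pairing a (RS_dual \<beta>) = (if \<alpha> = \<beta> then 1 else 0)"
    then have "pairing (a - Brs_prod \<alpha>) (RS_dual \<beta>) = 0" for \<beta>
      using pairing_linear_left(1) [of "a - Brs_prod \<alpha>" "Brs_prod \<alpha>" "RS_dual \<beta>"]
      by (simp add: pairing_Brs_prod_RS_dual)
    then show "a = Brs_prod \<alpha>"
      using RS_dual_separates [of "a - Brs_prod \<alpha>"] by simp
  qed
  then show ?thesis by (simp add: Brs_prod_def)
qed

end
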